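(* Let $F$ be a field of characteristic zero, let $\Gamma$ be a groupoid, and let $A=\bigoplus_{g\in\Gamma}A_g$ be a finite dimensional $\Gamma$-graded $F$-algebra (not necessarily associative). If $A$ is simple (as an algebra, in the non-graded sense), then its graded PI-exponent $$exp^{gr}(A)=\lim_{n\to\infty}\sqrt[n]{c_n^{gr}(A)}$$ exists.
   Context: Here a groupoid $\Gamma$ is a set with a binary operation (no associativity, commutativity or identity element is assumed). Algebras are over $F$ and not necessarily associative. An algebra $A$ is $\Gamma$-graded if $A=\bigoplus_{g\in\Gamma}A_g$ as a vector space and $A_gA_h\subseteq A_{gh}$ for all $g,h\in\Gamma$. $A$ is simple if it has no two-sided ideals other than $0$ and $A$ (homogeneous or not). The support is $\mathrm{Supp}\,A=\{g\in\Gamma: A_g\ne 0\}=\{g_1,\ldots,g_k\}$ (distinct elements). Let $F\{X\}$ be the absolutely free (nonassociative) algebra on $X=\bigcup_{g\in\Gamma}X_g$ (disjoint union), each $X_g$ infinite, graded by giving each $x\in X_g$ degree $g$. A polynomial $f(x_1,\ldots,x_m)$ with $x_i\in X_{h_i}$ is a graded identity of $A$ if $f(a_1,\ldots,a_m)=0$ for all $a_i\in A_{h_i}$; $Id^{gr}(A)$ is the ideal of all graded identities of $A$. For integers $n_1,\ldots,n_k\ge 0$ with $n_1+\cdots+n_k=n\ge 1$, let $P_{n_1,\ldots,n_k}$ be the space of multilinear polynomials of total degree $n$ in variables $x^{(i)}_1,\ldots,x^{(i)}_{n_i}\in X_{g_i}$, $1\le i\le k$. The partial codimension is $c_{n_1,\ldots,n_k}(A)=\dim\left(P_{n_1,\ldots,n_k}/(P_{n_1,\ldots,n_k}\cap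 Id^{gr}(A))\right)$, and the graded codimension is $$c_n^{gr}(A)=\sum_{n_1+\cdots+n_k=n}\binom{n}{n_1,\ldots,n_k}c_{n_1,\ldots,n_k}(A),$$ the sum being over nonnegative integers. The limit $exp^{gr}(A)$, if it exists, is called the graded PI-exponent of $A$. *)

theory Defs
  imports Complex_Main "HOL-Library.Multiset" "HOL-Library.Poly_Mapping"
begin

section \<open>Graded nonassociative algebras\<close>

locale nonassoc_algebra = vector_space scale
  for scale :: "'f::field \<Rightarrow> 'a::ab_group_add \<Rightarrow> 'a" +
  fixes mul :: "'a \<Rightarrow> 'a \<Rightarrow> 'a"
  assumes linear_mul_left: "Vector_Spaces.linear scale scale (\<lambda>x. mul x y)"
    and linear_mul_right: "Vector_Spaces.linear scale scale (\<lambda>y. mul x y)"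

text \<open>The groupoid is the type \<open>'g\<close> with the arbitrary binary operation \<open>gop\<close>. The assumption
  \<open>direct_sum\<close> says that the algebra is the internal direct sum of the \<open>A g\<close>: every vector is, in
  a unique way, a sum of a finitely supported family of homogeneous components.\<close>

locale graded_algebra = nonassoc_algebra scale mul
  for scale :: "'f::field \<Rightarrow> 'a::ab_group_add \<Rightarrow> 'a" and mul :: "'a \<Rightarrow> 'a \<Rightarrow> 'a" +
  fixes gop :: "'g \<Rightarrow> 'g \<Rightarrow> 'g" and A :: "'g \<Rightarrow> 'a set"
  assumes subspace_component: "subspace (A g)"
    and direct_sum:
      "\<exists>!c. (\<forall>g. c g \<in> A g) \<and> finite {g. c g \<noteq> 0} \<and> v = (\<Sum>g | c g \<noteq> 0. c g)"
    and mul_component: "\<lbrakk>a \<in> A g; b \<in> A h\<rbrakk> \<Longrightarrow> mul a b \<in> A (gop g h)"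

definition two_sided_ideal ::
  "('f::field \<Rightarrow> 'a::ab_group_add \<Rightarrow> 'a) \<Rightarrow> ('a \<Rightarrow> 'a \<Rightarrow> 'a) \<Rightarrow> 'a set \<Rightarrow> bool" where
  "two_sided_ideal scale mul I \<longleftrightarrow>
     module.subspace scale I \<and> (\<forall>a. \<forall>x\<in>I. mul a x \<in> I \<and> mul x a \<in> I)"

text \<open>No condition of the form \<open>A\<^sup>2 \<noteq> 0\<close> is imposed, and the ideals need not be homogeneous.\<close>

definition simple_algebra ::
  "('f::field \<Rightarrow> 'a::ab_group_add \<Rightarrow> 'a) \<Rightarrow> ('a \<Rightarrow> 'a \<Rightarrow> 'a) \<Rightarrow> bool" where
  "simple_algebra scale mul \<longleftrightarrow>
     (\<forall>I. two_sided_ideal scale mul I \<longrightarrow> I = {0} \<or> I = UNIV)"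

definition Supp :: "('g \<Rightarrow> 'a::zero set) \<Rightarrow> 'g set" where
  "Supp A = {g. A g \<noteq> {0}}"

section \<open>The absolutely free algebra and graded identities\<close>

text \<open>Nonassociative monomials are nonempty bracketed words. The absolutely free algebra on \<open>'x\<close>
  is the vector space of finitely supported functions from these monomials to the field; only its
  linear structure is needed below.\<close>

datatype 'x monomial = Var 'x | Prod "'x monomial" "'x monomial"

type_synonym ('x, 'f) free_alg = "'x monomial \<Rightarrow>\<^sub>0 'f"

primrec monomial_vars :: "'x monomial \<Rightarrow> 'x multiset" where
  "monomial_vars (Var x) = {#x#}"
| "monomial_vars (Prod s t) = monomial_vars s + monomial_vars t"

definition free_scale :: "'f::field \<Rightarrow> ('x, 'f) free_alg \<Rightarrow> ('x, 'f) free_alg" where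
  "free_scale c f = Poly_Mapping.map ((*) c) f"

lemma lookup_free_scale:
  "Poly_Mapping.lookup (free_scale c f) m = c * Poly_Mapping.lookup f m"
  by (simp add: free_scale_def Poly_Mapping.map.rep_eq when_def)

lemma vector_space_free_scale: "vector_space free_scale"
  by unfold_locales
    (auto intro!: poly_mapping_eqI simp: lookup_free_scale lookup_add algebra_simps)

primrec eval_monomial :: "('a \<Rightarrow> 'a \<Rightarrow> 'a) \<Rightarrow> ('x \<Rightarrow> 'a) \<Rightarrow> 'x monomial \<Rightarrow> 'a" where
  "eval_monomial mul a (Var x) = a x"
| "eval_monomial mul a (Prod s t) = mul (eval_monomial mul a s) (eval_monomial mul a t)"

definition eval_poly ::
  "('f::field \<Rightarrow> 'a::ab_group_add \<Rightarrow> 'a) \<Rightarrow> ('a \<Rightarrow> 'a \<Rightarrow> 'a) \<Rightarrow> ('x \<Rightarrow> 'a) \<Rightarrow> ('x, 'f) free_alg \<Rightarrow> 'a"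
where
  "eval_poly scale mul a f =
     (\<Sum>m\<in>Poly_Mapping.keys f. scale (Poly_Mapping.lookup f m) (eval_monomial mul a m))"

text \<open>The variables of degree \<open>g\<close> are the pairs \<open>(g, j)\<close>, so each degree has infinitely many.\<close>

definition graded_identities ::
  "('f::field \<Rightarrow> 'a::ab_group_add \<Rightarrow> 'a) \<Rightarrow> ('a \<Rightarrow> 'a \<Rightarrow> 'a) \<Rightarrow> ('g \<Rightarrow> 'a set) \<Rightarrow>
     ('g \<times> nat, 'f) free_alg set"
where
  "graded_identities scale mul A =
     {f. \<forall>a. (\<forall>g j. a (g, j) \<in> A g) \<longrightarrow> eval_poly scale mul a f = 0}"

section \<open>Codimensions\<close>

text \<open>The residue classes of the elements of \<open>B\<close> are pairwise distinct and form a basis of \<open>V / W\<close>.\<close>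

definition quotient_basis ::
  "('f::field \<Rightarrow> 'v::ab_group_add \<Rightarrow> 'v) \<Rightarrow> 'v set \<Rightarrow> 'v set \<Rightarrow> 'v set \<Rightarrow> bool" where
  "quotient_basis scale V W B \<longleftrightarrow> B \<subseteq> V \<and>
     (\<forall>T u. finite T \<longrightarrow> T \<subseteq> B \<longrightarrow> (\<Sum>b\<in>T. scale (u b) b) \<in> W \<longrightarrow> (\<forall>b\<in>T. u b = 0)) \<and>
     V \<subseteq> module.span scale (B \<union> W)"

definition quotient_dim ::
  "('f::field \<Rightarrow> 'v::ab_group_add \<Rightarrow> 'v) \<Rightarrow> 'v set \<Rightarrow> 'v set \<Rightarrow> nat" where
  "quotient_dim scale V W = card (SOME B. quotient_basis scale V W B)"

context vector_space
begin

lemma card_quotient_basis: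
  assumes W: "subspace W" "W \<subseteq> V" and D: "finite D" "V \<subseteq> span D"
    and B: "quotient_basis scale V W B"
  shows "card B = dim V - dim W"
proof -
  have BV: "B \<subseteq> V"
    and ind: "\<And>T u. \<lbrakk>finite T; T \<subseteq> B; (\<Sum>b\<in>T. u b *s b) \<in> W\<rbrakk> \<Longrightarrow> \<forall>b\<in>T. u b = 0"
    and spV: "V \<subseteq> span (B \<union> W)"
    using B unfolding quotient_basis_def by blast+
  obtain C where C: "C \<subseteq> W" "independent C" "W \<subseteq> span C" "card C = dim W"
    using basis_exists[of W] by metis
  have spC: "span C = W"
    using C W by (metis span_minimal subset_antisym)
  have disj: "B \<inter> C = {}"
  proof (rule ccontr)
    assume "B \<inter> C \<noteq> {}"
    then obtain b where "b \<in> B" "b \<in> C" by blast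
    with ind[of "{b}" "\<lambda>_. 1"] C(1) show False by auto
  qed
  have "independent (B \<union> C)"
    unfolding independent_explicit_module
  proof (intro allI impI)
    fix T u v
    assume T: "finite T" "T \<subseteq> B \<union> C" and s0: "(\<Sum>v\<in>T. u v *s v) = 0" and vT: "v \<in> T"
    have split: "T = (T \<inter> B) \<union> (T \<inter> C)" using T by blast
    have "(\<Sum>v\<in>T. u v *s v) = (\<Sum>v\<in>T \<inter> B. u v *s v) + (\<Sum>v\<in>T \<inter> C. u v *s v)"
      by (subst split, rule sum.union_disjoint) (use T disj in auto)
    then have eq: "(\<Sum>v\<in>T \<inter> B. u v *s v) = - (\<Sum>v\<in>T \<inter> C. u v *s v)"
      using s0 by (simp add: eq_neg_iff_add_eq_0)
    have "(\<Sum>v\<in>T \<inter> C. u v *s v) \<in> W"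
      using C(1) by (intro subspace_sum[OF W(1)] subspace_scale[OF W(1)]) auto
    then have "(\<Sum>v\<in>T \<inter> B. u v *s v) \<in> W"
      unfolding eq by (rule subspace_neg[OF W(1)])
    then have b0: "\<forall>b\<in>T \<inter> B. u b = 0"
      using ind[of "T \<inter> B" u] T by blast
    then have "(\<Sum>v\<in>T \<inter> C. u v *s v) = 0"
      using eq by simp
    then have "\<forall>c\<in>T \<inter> C. u c = 0"
      using C(2) T(1) unfolding independent_explicit_module by (metis finite_Int inf_le2)
    then show "u v = 0" using b0 vT T(2) by blast
  qed
  moreover have "V \<subseteq> span (B \<union> C)"
  proof -
    have "W \<subseteq> span (B \<union> C)"
      using spC span_mono[of C "B \<union> C"] by auto
    then have "span (B \<union> W) \<subseteq> span (B \<union> C)"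
      by (intro span_minimal) (auto intro: span_base)
    with spV show ?thesis by blast
  qed
  moreover have BCV: "B \<union> C \<subseteq> V" using BV C(1) W(2) by blast
  ultimately have "card (B \<union> C) = dim V" and fin: "finite (B \<union> C)"
    using basis_card_eq_dim independent_span_bound[OF D(1), of "B \<union> C"] D(2) by blast+
  then show ?thesis
    using disj C(4) by (simp add: card_Un_disjoint)
qed

lemma quotient_basis_exists:
  assumes W: "subspace W" "W \<subseteq> V"
  shows "\<exists>B. quotient_basis scale V W B"
proof -
  obtain C where C: "C \<subseteq> W" "independent C" "W \<subseteq> span C"
    using basis_exists[of W] by metis
  have spC: "span C = W"
    using C W by (metis span_minimal subset_antisym)
  have "C \<subseteq> V" using C W by blast
  then obtain E where E: "C \<subseteq> E" "E \<subseteq> V" "independent E" "V \<subseteq> span E"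
    using maximal_independent_subset_extend[OF _ C(2)] by metis
  have "quotient_basis scale V W (E - C)"
    unfolding quotient_basis_def
  proof (intro conjI allI impI)
    show "E - C \<subseteq> V" using E by blast
    have "span E \<subseteq> span (E - C \<union> W)"
      by (rule span_mono) (use C in auto)
    then show "V \<subseteq> span (E - C \<union> W)" using E(4) by blast
    fix T u
    assume T: "finite T" "T \<subseteq> E - C" and s: "(\<Sum>b\<in>T. u b *s b) \<in> W"
    then have "(\<Sum>b\<in>T. u b *s b) \<in> span C" by (simp add: spC)
    then obtain S r where S: "finite S" "S \<subseteq> C" "(\<Sum>b\<in>T. u b *s b) = (\<Sum>a\<in>S. r a *s a)"
      unfolding span_explicit by auto
    define w where "w x = (if x \<in> T then u x else - r x)" for x
    have TS: "T \<inter> S = {}" using T S by blast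
    have "(\<Sum>x\<in>T \<union> S. w x *s x) = (\<Sum>x\<in>T. w x *s x) + (\<Sum>x\<in>S. w x *s x)"
      using T S TS by (intro sum.union_disjoint) auto
    also have "(\<Sum>x\<in>T. w x *s x) = (\<Sum>x\<in>T. u x *s x)"
      by (intro sum.cong) (auto simp: w_def)
    also have "(\<Sum>x\<in>S. w x *s x) = - (\<Sum>x\<in>S. r x *s x)"
      unfolding sum_negf[symmetric] using TS by (intro sum.cong) (auto simp: w_def)
    finally have "(\<Sum>x\<in>T \<union> S. w x *s x) = 0" using S(3) by simp
    moreover have "finite (T \<union> S)" "T \<union> S \<subseteq> E" using T S E by auto
    ultimately have "\<forall>x\<in>T \<union> S. w x = 0"
      using E(3) unfolding independent_explicit_module by metis
    then show "\<forall>b\<in>T. u b = 0" unfolding w_def by (metis UnI1)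
  qed
  then show ?thesis by blast
qed

lemma quotient_dim_eq:
  assumes "subspace W" "W \<subseteq> V" "finite D" "V \<subseteq> span D"
  shows "quotient_dim scale V W = dim V - dim W"
  unfolding quotient_dim_def
  using card_quotient_basis[OF assms] someI_ex[OF quotient_basis_exists[OF assms(1,2)]] by blast

end

text \<open>A tuple \<open>(n\<^sub>1, \<dots>, n\<^sub>k)\<close> indexed by the support \<open>{g\<^sub>1, \<dots>, g\<^sub>k}\<close> is encoded as a function
  \<open>\<nu>\<close> that vanishes outside the support, with \<open>\<nu> g\<^sub>i = n\<^sub>i\<close>; the variables of degree \<open>g\<close> in
  question are \<open>(g, 0), \<dots>, (g, \<nu> g - 1)\<close>, and a polynomial is multilinear if each of
  its monomials contains each of these variables exactly once and no others.
  The support of a finite-dimensional graded algebra is finite, so that all sums, products and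
  multisets over it are genuine.\<close>

definition degree_tuples :: "'g set \<Rightarrow> nat \<Rightarrow> ('g \<Rightarrow> nat) set" where
  "degree_tuples S n = {\<nu>. (\<forall>g. g \<notin> S \<longrightarrow> \<nu> g = 0) \<and> (\<Sum>g\<in>S. \<nu> g) = n}"

definition multilinear_polys :: "('g \<Rightarrow> nat) \<Rightarrow> ('g \<times> nat, 'f::field) free_alg set" where
  "multilinear_polys \<nu> =
     {f. \<forall>m\<in>Poly_Mapping.keys f. monomial_vars m = mset_set {(g, j). j < \<nu> g}}"

definition partial_codim ::
  "('f::field \<Rightarrow> 'a::ab_group_add \<Rightarrow> 'a) \<Rightarrow> ('a \<Rightarrow> 'a \<Rightarrow> 'a) \<Rightarrow> ('g \<Rightarrow> 'a set) \<Rightarrow> ('g \<Rightarrow> nat) \<Rightarrow> nat"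
where
  "partial_codim scale mul A \<nu> =
     quotient_dim free_scale (multilinear_polys \<nu>)
       (multilinear_polys \<nu> \<inter> graded_identities scale mul A)"

definition multinomial :: "'g set \<Rightarrow> ('g \<Rightarrow> nat) \<Rightarrow> nat" where
  "multinomial S \<nu> = fact (\<Sum>g\<in>S. \<nu> g) div (\<Prod>g\<in>S. fact (\<nu> g))"

definition graded_codim ::
  "('f::field \<Rightarrow> 'a::ab_group_add \<Rightarrow> 'a) \<Rightarrow> ('a \<Rightarrow> 'a \<Rightarrow> 'a) \<Rightarrow> ('g \<Rightarrow> 'a set) \<Rightarrow> nat \<Rightarrow> nat"
where
  "graded_codim scale mul A n =
     (\<Sum>\<nu>\<in>degree_tuples (Supp A) n. multinomial (Supp A) \<nu> * partial_codim scale mul A \<nu>)"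

end

theory Submission
  imports Defs "HOL-Combinatorics.Multiset_Permutations" "HOL-Library.List_Lexorder"
begin

text \<open>The codimensions are supermultiplicative up to a bounded shift of the index, and
  Fekete's lemma then gives the limit. What makes this work is that the codimensions can be
  replaced by the sizes of explicit sets of index lists, on which the simplicity of the algebra
  acts by appending letters.

  Fix finitely many homogeneous vectors \<open>e\<^sub>0, \<dots>, e\<^sub>d\<^sub>-\<^sub>1\<close> that contain a spanning set of every
  component. A multilinear polynomial is determined, modulo graded identities, by its values on
  tuples of such vectors, that is, on lists of indices. Order the lists of length \<open>n\<close>
  lexicographically and call a list \<open>t\<close> a pivot if some multilinear polynomial in \<open>n\<close> variables
  is nonzero at \<open>t\<close> but zero at all smaller lists with the same degrees. By Gaussian elimination
  the number of pivots with degrees \<open>\<phi>\<close> is at most the partial codimension for the content of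
  \<open>\<phi>\<close>, which in turn is at most \<open>d\<close> times that number. The multinomial coefficient of \<open>\<nu>\<close> counts
  the lists \<open>\<phi>\<close> of degrees with content \<open>\<nu>\<close>, so summing over \<open>\<phi>\<close> gives \<open>p\<^sub>n \<le> c\<^sub>n \<le> d p\<^sub>n\<close> for
  the number \<open>p\<^sub>n\<close> of pivots of length \<open>n\<close> (\<open>graded_codim_bounds\<close>).

  Suppose first that the product is not identically zero. Let \<open>f\<close> and \<open>g\<close> witness the pivots \<open>t\<close>
  and \<open>u\<close>. Both \<open>f(t)\<close> and \<open>g(u)\<close> generate the whole algebra as an ideal, and they do so within
  a number \<open>N\<close> of multiplications by frame vectors that is bounded by the dimension. As the
  product is not identically zero, there are multiplication words \<open>w\<close>, \<open>w'\<close> of length at most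
  \<open>N\<close> with \<open>w(f(t)) w'(g(u)) \<noteq> 0\<close>. Replacing the frame vectors in the words by new variables
  yields a multilinear polynomial that vanishes as soon as \<open>f\<close> or \<open>g\<close> does. The first list with
  the relevant degrees at which it is nonzero therefore has the prefix \<open>t @ u\<close>: this list
  extends by at most \<open>2 N\<close> letters to a pivot (\<open>pivot_lists_append\<close>). As simplicity also
  forces the annihilator to be zero, each pivot extends by one letter, so that the number of
  appended letters can be made constant. Appending at the end is injective, which gives
  \<open>p\<^sub>n p\<^sub>m \<le> p\<^sub>n\<^sub>+\<^sub>m\<^sub>+\<^sub>2\<^sub>N\<close> and \<open>p\<^sub>n \<le> p\<^sub>n\<^sub>+\<^sub>1\<close> (\<open>card_pivot_lists_growth\<close>). Together with \<open>p\<^sub>n \<le> d\<^sup>n\<close>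
  this is what Fekete's argument needs (\<open>root_convergent_if_supermultiplicative\<close>).

  If the product is identically zero, then \<open>c\<^sub>n = 0\<close> for \<open>n \<ge> 2\<close>.\<close>

section \<open>Counting a quotient dimension by pivots\<close>

text \<open>Gaussian elimination: an equation with a nonzero coefficient serves to eliminate one
  unknown from the remaining equations.\<close>

lemma homogeneous_system_nontrivial:
  fixes a :: "'i \<Rightarrow> 'j \<Rightarrow> 'f::field"
  assumes "finite J" "finite I" "card J < card I"
  shows "\<exists>u. (\<exists>i\<in>I. u i \<noteq> 0) \<and> (\<forall>j\<in>J. (\<Sum>i\<in>I. u i * a i j) = 0)"
  using assms
proof (induction J arbitrary: I a rule: finite_induct)
  case empty
  then have "I \<noteq> {}" by auto
  then show ?case by (intro exI[of _ "\<lambda>_. 1"]) auto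
next
  case (insert j0 J)
  show ?case
  proof (cases "\<forall>i\<in>I. a i j0 = 0")
    case True
    obtain u where "\<exists>i\<in>I. u i \<noteq> 0" "\<forall>j\<in>J. (\<Sum>i\<in>I. u i * a i j) = 0"
      using insert.IH[of I a] insert.prems insert.hyps by auto
    then show ?thesis using True by (intro exI[of _ u]) auto
  next
    case False
    then obtain i0 where i0: "i0 \<in> I" "a i0 j0 \<noteq> 0" by blast
    define I' where "I' = I - {i0}"
    have I: "I = insert i0 I'" "i0 \<notin> I'" "finite I'"
      using i0 insert.prems by (auto simp: I'_def)
    then have cI: "card I = Suc (card I')" by simp
    obtain u where u: "\<exists>i\<in>I'. u i \<noteq> 0"
        "\<forall>j\<in>J. (\<Sum>i\<in>I'. u i * (a i j - a i j0 / a i0 j0 * a i0 j)) = 0"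
      using insert.IH[of I' "\<lambda>i j. a i j - a i j0 / a i0 j0 * a i0 j"] insert.prems insert.hyps
        I(3) cI by auto
    \<comment> \<open>Equation \<open>j0\<close> determines the unknown \<open>i0\<close> from the others.\<close>
    define w where "w = u(i0 := - (\<Sum>i\<in>I'. u i * a i j0) / a i0 j0)"
    have sum_w: "(\<Sum>i\<in>I. w i * a i j) =
        (\<Sum>i\<in>I'. u i * a i j) - (\<Sum>i\<in>I'. u i * a i j0) / a i0 j0 * a i0 j" for j
    proof -
      have "(\<Sum>i\<in>I'. w i * a i j) = (\<Sum>i\<in>I'. u i * a i j)"
        using I(2) by (intro sum.cong) (auto simp: w_def)
      then show ?thesis using I by (simp add: w_def)
    qed
    have "(\<Sum>i\<in>I. w i * a i j) = 0" if "j \<in> insert j0 J" for j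
    proof (cases "j = j0")
      case True
      then show ?thesis using sum_w i0(2) by simp
    next
      case False
      then have "j \<in> J" using that by simp
      have "(\<Sum>i\<in>I'. u i * a i j0) / a i0 j0 * a i0 j =
          (\<Sum>i\<in>I'. u i * (a i j0 / a i0 j0 * a i0 j))"
        unfolding sum_divide_distrib sum_distrib_right by (simp add: mult.assoc)
      then have "(\<Sum>i\<in>I. w i * a i j) =
          (\<Sum>i\<in>I'. u i * (a i j - a i j0 / a i0 j0 * a i0 j))"
        unfolding sum_w right_diff_distrib sum_subtractf by (simp only:)
      also have "\<dots> = 0" using u(2) \<open>j \<in> J\<close> by (rule bspec)
      finally show ?thesis .
    qed
    moreover have "\<exists>i\<in>I. w i \<noteq> 0" using u(1) I by (auto simp: w_def)
    ultimately show ?thesis by blast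
  qed
qed

text \<open>Expressing the \<open>f t\<close> through \<open>B\<close> modulo \<open>W\<close> with fewer coefficients than there are
  indices \<open>t\<close> would leave a nontrivial linear relation among them.\<close>

lemma (in vector_space) quotient_basis_card_ge:
  assumes W: "subspace W" and B: "quotient_basis scale V W B" "finite B"
    and T: "finite T" "\<And>t. t \<in> T \<Longrightarrow> f t \<in> V"
    and ind: "\<And>u. (\<Sum>t\<in>T. scale (u t) (f t)) \<in> W \<Longrightarrow> \<forall>t\<in>T. u t = 0"
  shows "card T \<le> card B"
proof (rule ccontr)
  assume less: "\<not> card T \<le> card B"
  have "\<exists>r. f t - (\<Sum>b\<in>B. scale (r b) b) \<in> W" if "t \<in> T" for t
  proof -
    have "f t \<in> span (B \<union> W)"
      using T(2)[OF that] B(1) unfolding quotient_basis_def by blast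
    then obtain x y where xy: "f t = x + y" "x \<in> span B" "y \<in> span W"
      unfolding span_Un by blast
    obtain r where "x = (\<Sum>b\<in>B. scale (r b) b)"
      using xy(2) unfolding span_finite[OF B(2)] by blast
    then have "f t - (\<Sum>b\<in>B. scale (r b) b) = y" using xy(1) by simp
    then show ?thesis using xy(3) span_eq_iff[THEN iffD2, OF W] by auto
  qed
  then obtain r where r: "\<And>t. t \<in> T \<Longrightarrow> f t - (\<Sum>b\<in>B. scale (r t b) b) \<in> W"
    by metis
  obtain u where u: "\<exists>t\<in>T. u t \<noteq> 0" "\<forall>b\<in>B. (\<Sum>t\<in>T. u t * r t b) = 0"
    using homogeneous_system_nontrivial[OF B(2) T(1), of r] less by auto
  have "(\<Sum>t\<in>T. scale (u t) (f t - (\<Sum>b\<in>B. scale (r t b) b))) \<in> W"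
    by (intro subspace_sum[OF W] subspace_scale[OF W] r)
  moreover have "(\<Sum>t\<in>T. scale (u t) (\<Sum>b\<in>B. scale (r t b) b)) = 0"
  proof -
    have "(\<Sum>t\<in>T. scale (u t) (\<Sum>b\<in>B. scale (r t b) b)) =
        (\<Sum>b\<in>B. \<Sum>t\<in>T. scale (u t * r t b) b)"
      by (subst sum.swap) (simp add: scale_sum_right)
    also have "\<dots> = (\<Sum>b\<in>B. scale (\<Sum>t\<in>T. u t * r t b) b)"
      by (simp add: scale_sum_left)
    finally show ?thesis using u(2) by simp
  qed
  ultimately have "(\<Sum>t\<in>T. scale (u t) (f t)) \<in> W"
    by (simp add: scale_right_diff_distrib sum_subtractf)
  then show False using ind u(1) by blast
qed

text \<open>The linear maps \<open>ev t\<close> play the role of the columns of a matrix whose rows are the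
  elements of \<open>V\<close>; the pivots are the columns in which a row of \<open>V\<close> can have its first nonzero
  entry.\<close>

definition pivots :: "'v set \<Rightarrow> ('t::linorder \<Rightarrow> 'v \<Rightarrow> 'w::zero) \<Rightarrow> 't set \<Rightarrow> 't set" where
  "pivots V ev T = {t\<in>T. \<exists>v\<in>V. ev t v \<noteq> 0 \<and> (\<forall>s\<in>T. s < t \<longrightarrow> ev s v = 0)}"

text \<open>The first index at which a vector does not vanish is a pivot.\<close>

lemma vanishes_if_vanishes_on_pivots:
  assumes "finite T" "v \<in> V" "\<And>t. t \<in> pivots V ev T \<Longrightarrow> ev t v = 0" "t \<in> T"
  shows "ev t v = 0"
proof (rule ccontr)
  assume nz: "ev t v \<noteq> 0"
  define S where "S = {t\<in>T. ev t v \<noteq> 0}"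
  have S: "finite S" "S \<noteq> {}" using assms nz by (auto simp: S_def)
  then have m: "Min S \<in> S" by simp
  have "ev s v = 0" if "s \<in> T" "s < Min S" for s
    using that Min_le[OF S(1), of s] by (force simp: S_def)
  then have "Min S \<in> pivots V ev T"
    using m assms(2) by (auto simp: pivots_def S_def)
  then show False using assms(3) m by (auto simp: S_def)
qed

context vector_space_pair
begin

text \<open>Vectors whose first nonzero entries lie at different pivots are independent modulo \<open>W\<close>,
  which is the lower bound. Conversely, evaluation at the pivots embeds \<open>V / W\<close> into a power of
  the target space, with one factor for each pivot.\<close>

theorem pivots_quotient_dim:
  fixes ev :: "'t::linorder \<Rightarrow> 'b \<Rightarrow> 'c"
  assumes T: "finite T" and V: "vs1.subspace V"
    and lin: "\<And>t. t \<in> T \<Longrightarrow> Vector_Spaces.linear s1 s2 (ev t)"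
    and E: "finite E" "vs2.span E = UNIV"
  defines "W \<equiv> {v\<in>V. \<forall>t\<in>T. ev t v = 0}"
  shows "card (pivots V ev T) \<le> quotient_dim s1 V W"
    and "quotient_dim s1 V W \<le> card E * card (pivots V ev T)"
proof -
  have evsum: "ev t (\<Sum>i\<in>I. s1 (u i) (f i)) = (\<Sum>i\<in>I. s2 (u i) (ev t (f i)))"
    if "t \<in> T" for t I u and f :: "'i \<Rightarrow> 'b"
    using lin[OF that] by (simp add: linear_sum linear_scale)
  have W: "vs1.subspace W" "W \<subseteq> V"
    using V lin unfolding W_def vs1.subspace_def
    by (auto simp: linear_0 linear_add linear_scale)
  define B where "B = (SOME B. quotient_basis s1 V W B)"
  have B: "quotient_basis s1 V W B"
    unfolding B_def using someI_ex[OF vs1.quotient_basis_exists[OF W]] .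
  have dimB: "quotient_dim s1 V W = card B" by (simp add: quotient_dim_def B_def)
  let ?P = "pivots V ev T"
  have P: "finite ?P" "?P \<subseteq> T" using T by (auto simp: pivots_def)
  have bound: "card C \<le> card E * card ?P" if C: "C \<subseteq> B" "finite C" for C
  proof (rule ccontr)
    assume less: "\<not> card C \<le> card E * card ?P"
    have "\<forall>x. \<exists>r. x = (\<Sum>e\<in>E. s2 (r e) e)"
      using vs2.span_finite[OF E(1)] E(2) by (auto simp: image_iff)
    then obtain r where r: "\<And>x. x = (\<Sum>e\<in>E. s2 (r x e) e)" by metis
    have "card (?P \<times> E) < card C"
      using less by (simp add: card_cartesian_product mult.commute)
    then obtain u where u: "\<exists>b\<in>C. u b \<noteq> 0"
        "\<forall>j\<in>?P \<times> E. (\<Sum>b\<in>C. u b * r (ev (fst j) b) (snd j)) = 0"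
      using homogeneous_system_nontrivial[of "?P \<times> E" C "\<lambda>b j. r (ev (fst j) b) (snd j)"]
        C(2) P(1) E(1) by auto
    have CV: "C \<subseteq> V" using B C unfolding quotient_basis_def by blast
    have "ev t (\<Sum>b\<in>C. s1 (u b) b) = 0" if "t \<in> ?P" for t
    proof -
      have "ev t (\<Sum>b\<in>C. s1 (u b) b) = (\<Sum>b\<in>C. s2 (u b) (ev t b))"
        using evsum[of t u "\<lambda>b. b"] that P(2) by blast
      also have "\<dots> = (\<Sum>b\<in>C. s2 (u b) (\<Sum>e\<in>E. s2 (r (ev t b) e) e))"
        using r by simp
      also have "\<dots> = (\<Sum>e\<in>E. \<Sum>b\<in>C. s2 (u b * r (ev t b) e) e)"
        by (subst sum.swap) (simp add: vs2.scale_sum_right)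
      also have "\<dots> = (\<Sum>e\<in>E. s2 (\<Sum>b\<in>C. u b * r (ev t b) e) e)"
        by (simp add: vs2.scale_sum_left)
      also have "\<dots> = 0" using u(2) that by auto
      finally show ?thesis .
    qed
    moreover have inV: "(\<Sum>b\<in>C. s1 (u b) b) \<in> V"
      using CV by (intro vs1.subspace_sum[OF V] vs1.subspace_scale[OF V]) auto
    ultimately have "(\<Sum>b\<in>C. s1 (u b) b) \<in> W"
      using vanishes_if_vanishes_on_pivots[OF T inV, of ev] by (auto simp: W_def)
    then show False using B C u(1) unfolding quotient_basis_def by blast
  qed
  have finB: "finite B"
  proof (rule ccontr)
    assume "infinite B"
    then obtain C where "C \<subseteq> B" "finite C" "card C = Suc (card E * card ?P)"
      using infinite_arbitrarily_large by blast
    then show False using bound[of C] by simp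
  qed
  then show "quotient_dim s1 V W \<le> card E * card ?P"
    using bound[of B] dimB by simp
  have "\<forall>t\<in>?P. \<exists>v\<in>V. ev t v \<noteq> 0 \<and> (\<forall>s\<in>T. s < t \<longrightarrow> ev s v = 0)"
    by (auto simp: pivots_def)
  then obtain f where f: "\<And>t. t \<in> ?P \<Longrightarrow> f t \<in> V" "\<And>t. t \<in> ?P \<Longrightarrow> ev t (f t) \<noteq> 0"
      "\<And>s t. t \<in> ?P \<Longrightarrow> s \<in> T \<Longrightarrow> s < t \<Longrightarrow> ev s (f t) = 0"
    by metis
  have "\<forall>t\<in>?P. u t = 0" if "(\<Sum>t\<in>?P. s1 (u t) (f t)) \<in> W" for u
  proof (rule ccontr)
    assume "\<not> (\<forall>t\<in>?P. u t = 0)"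
    define S where "S = {t\<in>?P. u t \<noteq> 0}"
    have S: "finite S" "S \<noteq> {}" using P \<open>\<not> _\<close> by (auto simp: S_def)
    define t0 where "t0 = Min S"
    have t0: "t0 \<in> ?P" "u t0 \<noteq> 0" "t0 \<in> T"
      using Min_in[OF S] P(2) by (auto simp: S_def t0_def)
    have "s2 (u t) (ev t0 (f t)) = 0" if "t \<in> ?P - {t0}" for t
    proof (cases "u t = 0")
      case False
      then have "t \<in> S" using that by (auto simp: S_def)
      then have "t0 < t" using Min_le[OF S(1)] that unfolding t0_def by force
      then show ?thesis using f(3)[of t t0] that t0 by simp
    qed simp
    then have "(\<Sum>t\<in>?P - {t0}. s2 (u t) (ev t0 (f t))) = 0"
      by (intro sum.neutral) blast
    then have "(\<Sum>t\<in>?P. s2 (u t) (ev t0 (f t))) = s2 (u t0) (ev t0 (f t0))"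
      using sum.remove[OF P(1) t0(1), of "\<lambda>t. s2 (u t) (ev t0 (f t))"] by simp
    moreover have "ev t0 (\<Sum>t\<in>?P. s1 (u t) (f t)) = 0"
      using that t0(3) by (simp add: W_def)
    ultimately show False using evsum[OF t0(3), of u f ?P] t0 f(2)[OF t0(1)] by simp
  qed
  then show "card ?P \<le> quotient_dim s1 V W"
    unfolding dimB using vs1.quotient_basis_card_ge[OF W(1) B finB P(1), of f] f(1) by blast
qed

end

section \<open>Multilinear polynomial maps\<close>

lemma (in vector_space) eval_poly_superset:
  assumes "finite K" "Poly_Mapping.keys f \<subseteq> K"
  shows "eval_poly scale mul a f =
    (\<Sum>m\<in>K. scale (Poly_Mapping.lookup f m) (eval_monomial mul a m))"
  unfolding eval_poly_def using assms
  by (intro sum.mono_neutral_left) (auto simp: in_keys_iff)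

lemma (in vector_space) linear_eval_poly:
  "Vector_Spaces.linear free_scale scale (eval_poly scale mul a)"
proof -
  interpret free: vector_space free_scale by (rule vector_space_free_scale)
  interpret vector_space_pair free_scale scale by unfold_locales
  have "eval_poly scale mul a (f + g) = eval_poly scale mul a f + eval_poly scale mul a g" for f g
  proof -
    let ?K = "Poly_Mapping.keys f \<union> Poly_Mapping.keys g"
    have "Poly_Mapping.keys (f + g) \<subseteq> ?K" by (rule keys_add)
    then show ?thesis
      using eval_poly_superset[of ?K "f + g"] eval_poly_superset[of ?K f] eval_poly_superset[of ?K g]
      by (simp add: lookup_add scale_left_distrib sum.distrib)
  qed
  moreover have "eval_poly scale mul a (free_scale c f) = scale c (eval_poly scale mul a f)" for c f
  proof -
    have "Poly_Mapping.keys (free_scale c f) \<subseteq> Poly_Mapping.keys f"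
      by (auto simp: in_keys_iff lookup_free_scale)
    then show ?thesis
      using eval_poly_superset[of "Poly_Mapping.keys f" "free_scale c f"]
      by (simp add: lookup_free_scale eval_poly_def scale_sum_right)
  qed
  ultimately show ?thesis
    unfolding Vector_Spaces.linear_iff
    using vector_space_axioms vector_space_free_scale by blast
qed

text \<open>Multilinearity is the case of a multiset without repetition.\<close>

definition polys_with_vars :: "'x multiset \<Rightarrow> ('x, 'f::field) free_alg set" where
  "polys_with_vars M = {f. \<forall>m\<in>Poly_Mapping.keys f. monomial_vars m = M}"

context nonassoc_algebra
begin

lemma mul_zero_left [simp]: "mul 0 y = 0"
  and mul_zero_right [simp]: "mul x 0 = 0"
  and mul_add_left: "mul (x + x') y = mul x y + mul x' y"
  and mul_add_right: "mul x (y + y') = mul x y + mul x y'"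
  and mul_scale_left: "mul (scale c x) y = scale c (mul x y)"
  and mul_scale_right: "mul x (scale c y) = scale c (mul x y)"
  and mul_sum_left: "mul (sum f I) y = (\<Sum>i\<in>I. mul (f i) y)"
  and mul_sum_right: "mul x (sum g J) = (\<Sum>j\<in>J. mul x (g j))"
proof -
  interpret vector_space_pair scale scale by unfold_locales
  note l = linear_mul_left[of y] and r = linear_mul_right[of x]
  show "mul 0 y = 0" "mul x 0 = 0"
    using linear_0[OF l] linear_0[OF r] by auto
  show "mul (x + x') y = mul x y + mul x' y" "mul x (y + y') = mul x y + mul x y'"
    using linear_add[OF l] linear_add[OF r] by auto
  show "mul (scale c x) y = scale c (mul x y)" "mul x (scale c y) = scale c (mul x y)"
    using linear_scale[OF l] linear_scale[OF r] by auto
  show "mul (sum f I) y = (\<Sum>i\<in>I. mul (f i) y)" "mul x (sum g J) = (\<Sum>j\<in>J. mul x (g j))"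
    using linear_sum[OF l] linear_sum[OF r] by auto
qed

text \<open>Passing from polynomials to the maps they induce on assignments makes substitution and
  multiplication of polynomials plain operations on functions.\<close>

definition poly_maps :: "'x multiset \<Rightarrow> (('x \<Rightarrow> 'a) \<Rightarrow> 'a) set" where
  "poly_maps M = (\<lambda>f a. eval_poly scale mul a f) ` polys_with_vars M"

lemma poly_mapsI:
  assumes "finite I" "\<And>i. i \<in> I \<Longrightarrow> monomial_vars (m i) = M"
  shows "(\<lambda>a. \<Sum>i\<in>I. scale (c i) (eval_monomial mul a (m i))) \<in> poly_maps M"
proof -
  interpret free: vector_space free_scale by (rule vector_space_free_scale)
  interpret vector_space_pair free_scale scale by unfold_locales
  define f where "f = (\<Sum>i\<in>I. Poly_Mapping.single (m i) (c i))"
  have "Poly_Mapping.keys f \<subseteq> (\<Union>i\<in>I. Poly_Mapping.keys (Poly_Mapping.single (m i) (c i)))"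
    unfolding f_def by (rule keys_sum)
  then have "f \<in> polys_with_vars M"
    using assms(2) by (fastforce simp: polys_with_vars_def split: if_splits)
  moreover have "eval_poly scale mul a f = (\<Sum>i\<in>I. scale (c i) (eval_monomial mul a (m i)))" for a
  proof -
    have "eval_poly scale mul a (Poly_Mapping.single (m i) (c i)) =
        scale (c i) (eval_monomial mul a (m i))" for i
      using eval_poly_superset[of "{m i}" "Poly_Mapping.single (m i) (c i)" mul a] by simp
    then show ?thesis
      by (simp add: f_def linear_sum[OF linear_eval_poly])
  qed
  ultimately show ?thesis unfolding poly_maps_def by (intro image_eqI[of _ _ f]) (simp_all add: fun_eq_iff)
qed

lemma poly_mapsE:
  assumes "F \<in> poly_maps M"
  obtains K c where "finite K" "\<forall>m\<in>K. monomial_vars m = M"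
    "F = (\<lambda>a. \<Sum>m\<in>K. scale (c m) (eval_monomial mul a m))"
proof -
  obtain f where f: "f \<in> polys_with_vars M" "F = (\<lambda>a. eval_poly scale mul a f)"
    using assms unfolding poly_maps_def by auto
  show ?thesis
    by (rule that[of "Poly_Mapping.keys f" "Poly_Mapping.lookup f"])
      (use f in \<open>auto simp: polys_with_vars_def eval_poly_def\<close>)
qed

lemma poly_maps_var: "(\<lambda>a. a x) \<in> poly_maps {#x#}"
  using poly_mapsI[of "{()}" "\<lambda>_. Var x" "{#x#}" "\<lambda>_. 1"] by simp

lemma poly_maps_mul:
  assumes "F \<in> poly_maps M" "G \<in> poly_maps N"
  shows "(\<lambda>a. mul (F a) (G a)) \<in> poly_maps (M + N)"
proof -
  obtain K c where K: "finite K" "\<forall>m\<in>K. monomial_vars m = M"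
      "F = (\<lambda>a. \<Sum>m\<in>K. scale (c m) (eval_monomial mul a m))"
    using poly_mapsE[OF assms(1)] .
  obtain L d where L: "finite L" "\<forall>m\<in>L. monomial_vars m = N"
      "G = (\<lambda>a. \<Sum>m\<in>L. scale (d m) (eval_monomial mul a m))"
    using poly_mapsE[OF assms(2)] .
  have "mul (F a) (G a) = (\<Sum>p\<in>K \<times> L. scale (c (fst p) * d (snd p))
      (eval_monomial mul a (Prod (fst p) (snd p))))" for a
    unfolding K(3) L(3)
    by (simp only: mul_sum_left mul_scale_left)
      (simp add: mul_sum_right mul_scale_right scale_sum_right sum.cartesian_product split_def)
  then show ?thesis
    using poly_mapsI[of "K \<times> L" "\<lambda>p. Prod (fst p) (snd p)" "M + N"
      "\<lambda>p. c (fst p) * d (snd p)"] K L by auto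
qed

lemma monomial_vars_map_monomial:
  "monomial_vars (map_monomial \<rho> m) = image_mset \<rho> (monomial_vars m)"
  by (induction m) auto

lemma eval_monomial_map_monomial:
  "eval_monomial mul a (map_monomial \<rho> m) = eval_monomial mul (a \<circ> \<rho>) m"
  by (induction m) auto

lemma eval_monomial_cong:
  assumes "\<And>x. x \<in># monomial_vars m \<Longrightarrow> a x = b x"
  shows "eval_monomial mul a m = eval_monomial mul b m"
  using assms by (induction m) auto

lemma poly_maps_rename:
  assumes "F \<in> poly_maps M"
  shows "(\<lambda>a. F (a \<circ> \<rho>)) \<in> poly_maps (image_mset \<rho> M)"
proof -
  obtain K c where K: "finite K" "\<forall>m\<in>K. monomial_vars m = M"
      "F = (\<lambda>a. \<Sum>m\<in>K. scale (c m) (eval_monomial mul a m))"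
    using poly_mapsE[OF assms(1)] .
  then show ?thesis
    using poly_mapsI[of K "map_monomial \<rho>" "image_mset \<rho> M" c]
    by (simp add: monomial_vars_map_monomial eval_monomial_map_monomial)
qed

lemma poly_maps_cong:
  assumes "F \<in> poly_maps M" "\<And>x. x \<in># M \<Longrightarrow> a x = b x"
  shows "F a = F b"
proof -
  obtain K c where K: "finite K" "\<forall>m\<in>K. monomial_vars m = M"
      "F = (\<lambda>a. \<Sum>m\<in>K. scale (c m) (eval_monomial mul a m))"
    using poly_mapsE[OF assms(1)] .
  show ?thesis
    unfolding K(3) by (intro sum.cong refl arg_cong2[where f = scale] eval_monomial_cong)
      (use K(2) assms(2) in auto)
qed

text \<open>In a product exactly one of the factors contains the variable, and the other one is
  constant.\<close>

lemma eval_monomial_linear_var: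
  assumes "count (monomial_vars m) x = 1"
  shows "Vector_Spaces.linear scale scale (\<lambda>v. eval_monomial mul (a(x := v)) m)"
  using assms
proof (induction m)
  case (Var y)
  then show ?case using linear_id by (auto split: if_splits simp: id_def)
next
  case (Prod s t)
  have cong: "eval_monomial mul (a(x := v)) r = eval_monomial mul a r"
    if "count (monomial_vars r) x = 0" for r v
    by (rule eval_monomial_cong) (use that in \<open>auto simp: count_eq_zero_iff\<close>)
  interpret vector_space_pair scale scale by unfold_locales
  consider "count (monomial_vars s) x = 1" "count (monomial_vars t) x = 0" |
    "count (monomial_vars s) x = 0" "count (monomial_vars t) x = 1"
    using Prod.prems by force
  then show ?case
  proof cases
    case 1
    have "(\<lambda>v. eval_monomial mul (a(x := v)) (Prod s t)) =
        (\<lambda>y. mul y (eval_monomial mul a t)) \<circ> (\<lambda>v. eval_monomial mul (a(x := v)) s)"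
      using cong[OF 1(2)] by (simp only: eval_monomial.simps o_def)
    then show ?thesis
      by (simp only: Vector_Spaces.linear_compose[OF Prod.IH(1)[OF 1(1)] linear_mul_left])
  next
    case 2
    have "(\<lambda>v. eval_monomial mul (a(x := v)) (Prod s t)) =
        (\<lambda>y. mul (eval_monomial mul a s) y) \<circ> (\<lambda>v. eval_monomial mul (a(x := v)) t)"
      using cong[OF 2(1)] by (simp only: eval_monomial.simps o_def)
    then show ?thesis
      by (simp only: Vector_Spaces.linear_compose[OF Prod.IH(2)[OF 2(2)] linear_mul_right])
  qed
qed

lemma poly_maps_linear_var:
  assumes "F \<in> poly_maps M" "count M x = 1"
  shows "Vector_Spaces.linear scale scale (\<lambda>v. F (a(x := v)))"
proof -
  interpret vector_space_pair scale scale by unfold_locales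
  obtain K c where K: "finite K" "\<forall>m\<in>K. monomial_vars m = M"
      "F = (\<lambda>a. \<Sum>m\<in>K. scale (c m) (eval_monomial mul a m))"
    using poly_mapsE[OF assms(1)] .
  show ?thesis
    unfolding K(3)
    by (intro linear_compose_sum ballI linear_compose_scale_right eval_monomial_linear_var)
      (use K(2) assms(2) in auto)
qed

text \<open>By linearity the arguments are moved one at a time from the spanning sets to their
  spans. This is why only the values on frame vectors matter for graded identities.\<close>

lemma poly_maps_eq_zero_if_spanning:
  assumes F: "F \<in> poly_maps M" and M: "\<And>x. x \<in># M \<Longrightarrow> count M x = 1"
    and zero: "\<And>a. (\<And>x. x \<in># M \<Longrightarrow> a x \<in> S x) \<Longrightarrow> F a = 0"
    and a: "\<And>x. x \<in># M \<Longrightarrow> a x \<in> span (S x)"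
  shows "F a = 0"
proof -
  have "F a = 0" if "Y \<subseteq> set_mset M" "\<And>x. x \<in> Y \<Longrightarrow> a x \<in> span (S x)"
      "\<And>x. x \<in># M \<Longrightarrow> x \<notin> Y \<Longrightarrow> a x \<in> S x" for Y a
    using finite_subset[OF that(1) finite_set_mset] that
  proof (induction Y arbitrary: a rule: finite_induct)
    case empty
    then show ?case using zero by auto
  next
    case (insert y Y)
    interpret vector_space_pair scale scale by unfold_locales
    have "y \<in># M" using insert.prems by auto
    let ?L = "\<lambda>v. F (a(y := v))"
    have lin: "Vector_Spaces.linear scale scale ?L"
      using poly_maps_linear_var[OF F M[OF \<open>y \<in># M\<close>]] .
    have "?L v = 0" if "v \<in> S y" for v
      by (rule insert.IH) (use insert.prems insert.hyps that in \<open>auto split: if_splits\<close>)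
    then have "?L v = 0" if "v \<in> span (S y)" for v
      using linear_eq_0_on_span[OF lin _ that] by blast
    from this[of "a y"] show ?case using insert.prems(2) by simp
  qed
  from this[of "set_mset M" a] show ?thesis using a by auto
qed

end

section \<open>Pivot lists over a homogeneous frame\<close>

lemma append_less_append_iff:
  fixes s t :: "'a::linorder list"
  assumes "length s = length t"
  shows "s @ v < t @ u \<longleftrightarrow> s < t \<or> s = t \<and> v < u"
  using assms by (induction s t rule: list_induct2) auto

text \<open>The numbering of the homogeneous spanning vectors is what orders the tuples of such vectors
  lexicographically, and with them the values of a polynomial.\<close>

locale homogeneous_frame = graded_algebra scale mul gop A
  for scale :: "'f::field \<Rightarrow> 'a::ab_group_add \<Rightarrow> 'a" and mul :: "'a \<Rightarrow> 'a \<Rightarrow> 'a"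
    and gop :: "'g \<Rightarrow> 'g \<Rightarrow> 'g" and A :: "'g \<Rightarrow> 'a set" +
  fixes e :: "nat \<Rightarrow> 'a" and \<delta> :: "nat \<Rightarrow> 'g" and d :: nat
  assumes frame_component: "i < d \<Longrightarrow> e i \<in> A (\<delta> i)"
    and frame_degree: "i < d \<Longrightarrow> \<delta> i \<in> Supp A"
    and component_span: "A g \<subseteq> span (e ` {i. i < d \<and> \<delta> i = g})"
    and finite_Supp: "finite (Supp A)"
begin

lemma frame_span: "span (e ` {..<d}) = UNIV"
proof -
  have "v \<in> span (e ` {..<d})" for v
  proof -
    obtain c where c: "\<forall>g. c g \<in> A g" "v = (\<Sum>g | c g \<noteq> 0. c g)"
      using direct_sum[of v] by blast
    have "c g \<in> span (e ` {..<d})" for g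
      using c(1) component_span[of g] span_mono[of "e ` {i. i < d \<and> \<delta> i = g}" "e ` {..<d}"] by blast
    then show ?thesis unfolding c(2) by (intro span_sum)
  qed
  then show ?thesis by blast
qed

definition frame_lists :: "nat \<Rightarrow> nat list set" where
  "frame_lists n = {t. length t = n \<and> set t \<subseteq> {..<d}}"

abbreviation frame_tuple :: "nat list \<Rightarrow> nat \<Rightarrow> 'a" where
  "frame_tuple t \<equiv> \<lambda>i. e (t ! i)"

text \<open>Only lists with the degrees of \<open>t\<close> are compared with \<open>t\<close>, because a graded polynomial is
  evaluated at arguments of prescribed degrees; all tuples of degrees are collected in one set
  of lists.\<close>

definition pivot_lists :: "nat \<Rightarrow> nat list set" where
  "pivot_lists n = {t\<in>frame_lists n. \<exists>F\<in>poly_maps (mset_set {..<n}).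
     F (frame_tuple t) \<noteq> 0 \<and> (\<forall>s\<in>frame_lists n. map \<delta> s = map \<delta> t \<longrightarrow> s < t \<longrightarrow> F (frame_tuple s) = 0)}"

lemma finite_frame_lists: "finite (frame_lists n)"
  using finite_lists_length_eq[of "{..<d}" n] by (simp add: frame_lists_def conj_commute)

lemma card_frame_lists: "card (frame_lists n) = d ^ n"
  using card_lists_length_eq[of "{..<d}" n] by (simp add: frame_lists_def conj_commute)

lemma append_frame_lists: "t \<in> frame_lists n \<Longrightarrow> u \<in> frame_lists m \<Longrightarrow> t @ u \<in> frame_lists (n + m)"
  by (auto simp: frame_lists_def)

lemma frame_lists_split:
  assumes "s \<in> frame_lists (n + m)"
  obtains t u where "s = t @ u" "t \<in> frame_lists n" "u \<in> frame_lists m"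
proof
  show "s = take n s @ drop n s" by simp
  show "take n s \<in> frame_lists n" "drop n s \<in> frame_lists m"
    using assms set_take_subset[of n s] set_drop_subset[of n s] by (auto simp: frame_lists_def)
qed

lemma pivot_lists_subset: "pivot_lists n \<subseteq> frame_lists n"
  by (auto simp: pivot_lists_def)

text \<open>In the lexicographic order the prefix decides first. Hence a polynomial that vanishes at
  all lists with a prefix below \<open>t\<close> but not on all extensions of \<open>t\<close> takes its first nonzero
  value, for the degrees at hand, at an extension of \<open>t\<close>.\<close>

lemma leading_extension:
  assumes H: "H \<in> poly_maps (mset_set {..<n + k})" and t: "t \<in> frame_lists n" and z: "z \<in> frame_lists k"
    and nz: "H (frame_tuple (t @ z)) \<noteq> 0"
    and low: "\<And>s v. \<lbrakk>s \<in> frame_lists n; v \<in> frame_lists k; map \<delta> s = map \<delta> t; s < t\<rbrakk> \<Longrightarrow> H (frame_tuple (s @ v)) = 0"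
  shows "\<exists>z'\<in>frame_lists k. t @ z' \<in> pivot_lists (n + k)"
proof -
  \<comment> \<open>The least continuation of \<open>t\<close> with the degrees of \<open>z\<close> is the one sought.\<close>
  define Z where "Z = {z'\<in>frame_lists k. map \<delta> z' = map \<delta> z \<and> H (frame_tuple (t @ z')) \<noteq> 0}"
  have Z: "finite Z" "Z \<noteq> {}" using z nz finite_frame_lists by (auto simp: Z_def)
  define z' where "z' = Min Z"
  have z': "z' \<in> Z" unfolding z'_def using Z by simp
  have "H (frame_tuple s) = 0" if s: "s \<in> frame_lists (n + k)" "map \<delta> s = map \<delta> (t @ z')" "s < t @ z'" for s
  proof -
    obtain q v where qv: "s = q @ v" "q \<in> frame_lists n" "v \<in> frame_lists k"
      using frame_lists_split[OF s(1)] .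
    have len: "length q = length t" using qv t by (simp add: frame_lists_def)
    then have deg: "map \<delta> q = map \<delta> t" "map \<delta> v = map \<delta> z'"
      using s(2) qv(1) by auto
    have "q < t \<or> q = t \<and> v < z'"
      using s(3) qv(1) append_less_append_iff[OF len] by simp
    then show ?thesis
    proof
      assume "q < t"
      then show ?thesis using low qv deg by simp
    next
      assume "q = t \<and> v < z'"
      moreover have "v \<notin> Z" if "v < z'"
        using that Min_le[OF Z(1), of v] by (auto simp: z'_def)
      ultimately show ?thesis using qv deg z' by (auto simp: Z_def)
    qed
  qed
  then show ?thesis
    using H z' append_frame_lists[OF t, of z' k] unfolding pivot_lists_def Z_def by blast
qed

text \<open>Words in the operators of left (\<open>True\<close>) and right (\<open>False\<close>) multiplication by frame
  vectors.\<close>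

primrec act :: "(bool \<times> nat) list \<Rightarrow> 'a \<Rightarrow> 'a" where
  "act [] a = a"
| "act (q # w) a =
     (if fst q then mul (e (snd q)) (act w a) else mul (act w a) (e (snd q)))"

text \<open>The word \<open>w\<close> is applied with its frame vectors replaced by the variables \<open>p, \<dots>, p +
  length w - 1\<close>, which keeps the result multilinear as long as these do not occur in \<open>M\<close>.
  Substituting the frame vectors back recovers the action of \<open>w\<close>, and every substitution
  preserves the zeros of \<open>F\<close>.\<close>

lemma poly_maps_act:
  assumes "F \<in> poly_maps M"
  shows "\<exists>F'\<in>poly_maps (M + mset_set {p..<p + length w}).
    (\<forall>x. (\<forall>i<length w. x (p + i) = e (snd (w ! i))) \<longrightarrow> F' x = act w (F x)) \<and>
    (\<forall>x. F x = 0 \<longrightarrow> F' x = 0)"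
proof (induction w arbitrary: p)
  case Nil
  then show ?case using assms by (intro bexI[of _ F]) auto
next
  case (Cons q w)
  obtain F' where F': "F' \<in> poly_maps (M + mset_set {Suc p..<Suc p + length w})"
      "\<And>x. (\<forall>i<length w. x (Suc p + i) = e (snd (w ! i))) \<Longrightarrow> F' x = act w (F x)"
      "\<And>x. F x = 0 \<Longrightarrow> F' x = 0"
    using Cons.IH[of "Suc p"] by blast
  have "{p..<p + length (q # w)} = insert p {Suc p..<Suc p + length w}" by auto
  then have vars: "M + mset_set {p..<p + length (q # w)} =
      {#p#} + (M + mset_set {Suc p..<Suc p + length w})"
    by simp
  define G where "G x = (if fst q then mul (x p) (F' x) else mul (F' x) (x p))" for x
  have "G \<in> poly_maps (M + mset_set {p..<p + length (q # w)})"
    using poly_maps_mul[OF poly_maps_var[of p] F'(1)] poly_maps_mul[OF F'(1) poly_maps_var[of p]]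
    unfolding vars G_def by (cases "fst q") (simp_all add: add.commute)
  moreover have "G x = act (q # w) (F x)"
    if x: "\<forall>i<length (q # w). x (p + i) = e (snd ((q # w) ! i))" for x
  proof -
    have "x (Suc p + i) = e (snd (w ! i))" if "i < length w" for i
      using x[rule_format, of "Suc i"] that by simp
    moreover have "x p = e (snd q)" using x[rule_format, of 0] by simp
    ultimately show ?thesis using F'(2)[of x] by (simp add: G_def)
  qed
  moreover have "G x = 0" if "F x = 0" for x
    using F'(3)[OF that] by (simp add: G_def)
  ultimately show ?case by blast
qed

lemma pivot_lists_extend_by_act:
  assumes t: "t \<in> pivot_lists n" and a: "\<And>a. a \<noteq> 0 \<Longrightarrow> \<exists>w. length w = k \<and> snd ` set w \<subseteq> {..<d} \<and> act w a \<noteq> 0"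
  shows "\<exists>z\<in>frame_lists k. t @ z \<in> pivot_lists (n + k)"
proof -
  obtain F where F: "F \<in> poly_maps (mset_set {..<n})" "F (frame_tuple t) \<noteq> 0"
      "\<And>s. s \<in> frame_lists n \<Longrightarrow> map \<delta> s = map \<delta> t \<Longrightarrow> s < t \<Longrightarrow> F (frame_tuple s) = 0"
    and tn: "t \<in> frame_lists n"
    using t unfolding pivot_lists_def by blast
  obtain w where w: "length w = k" "snd ` set w \<subseteq> {..<d}" "act w (F (frame_tuple t)) \<noteq> 0"
    using a[OF F(2)] by blast
  obtain F' where F': "F' \<in> poly_maps (mset_set {..<n} + mset_set {n..<n + k})"
      "\<And>x. (\<forall>i<k. x (n + i) = e (snd (w ! i))) \<Longrightarrow> F' x = act w (F x)"
      "\<And>x. F x = 0 \<Longrightarrow> F' x = 0"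
    using poly_maps_act[OF F(1), of n w] w(1) by blast
  have "{..<n + k} = {..<n} \<union> {n..<n + k}" by auto
  then have vars: "mset_set {..<n + k} = mset_set {..<n} + mset_set {n..<n + k}"
    by (simp add: mset_set_Union ivl_disj_int)
  have Fpre: "F (frame_tuple (s @ v)) = F (frame_tuple s)" if "s \<in> frame_lists n" for s v
    by (rule poly_maps_cong[OF F(1)]) (use that in \<open>auto simp: frame_lists_def nth_append\<close>)
  let ?z = "map snd w"
  show ?thesis
  proof (rule leading_extension)
    show "F' \<in> poly_maps (mset_set {..<n + k})" using F'(1) vars by simp
    show "t \<in> frame_lists n" "?z \<in> frame_lists k" using tn w by (auto simp: frame_lists_def)
    have "F' (frame_tuple (t @ ?z)) = act w (F (frame_tuple (t @ ?z)))"
      by (rule F'(2)) (use tn w(1) in \<open>auto simp: frame_lists_def nth_append\<close>)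
    then show "F' (frame_tuple (t @ ?z)) \<noteq> 0" using w(3) Fpre[OF tn] by simp
    show "F' (frame_tuple (s @ v)) = 0" if "s \<in> frame_lists n" "v \<in> frame_lists k" "map \<delta> s = map \<delta> t" "s < t" for s v
      using F'(3) Fpre[OF that(1)] F(3)[OF that(1,3,4)] by simp
  qed
qed

text \<open>The product of the two witnesses, each first multiplied by a word, vanishes at every
  list with a prefix below \<open>t @ u\<close> of the same degrees, since one of the two factors vanishes
  there; the hypothesis \<open>link\<close> says that the words can be chosen so that the product does not
  vanish at \<open>t @ u\<close> itself.\<close>

lemma pivot_lists_append:
  assumes t: "t \<in> pivot_lists n" and u: "u \<in> pivot_lists m"
    and link: "\<And>a b. \<lbrakk>a \<noteq> 0; b \<noteq> 0\<rbrakk> \<Longrightarrow> \<exists>w w'. length w \<le> N \<and> length w' \<le> N \<and>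
      snd ` set w \<subseteq> {..<d} \<and> snd ` set w' \<subseteq> {..<d} \<and> mul (act w a) (act w' b) \<noteq> 0"
  shows "\<exists>k\<le>2 * N. \<exists>z\<in>frame_lists k. t @ u @ z \<in> pivot_lists (n + m + k)"
proof -
  obtain F where F: "F \<in> poly_maps (mset_set {..<n})" "F (frame_tuple t) \<noteq> 0"
      "\<And>s. s \<in> frame_lists n \<Longrightarrow> map \<delta> s = map \<delta> t \<Longrightarrow> s < t \<Longrightarrow> F (frame_tuple s) = 0"
    and tn: "t \<in> frame_lists n"
    using t unfolding pivot_lists_def by blast
  obtain G where G: "G \<in> poly_maps (mset_set {..<m})" "G (frame_tuple u) \<noteq> 0"
      "\<And>s. s \<in> frame_lists m \<Longrightarrow> map \<delta> s = map \<delta> u \<Longrightarrow> s < u \<Longrightarrow> G (frame_tuple s) = 0"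
    and um: "u \<in> frame_lists m"
    using u unfolding pivot_lists_def by blast
  obtain w w' where w: "length w \<le> N" "length w' \<le> N" "snd ` set w \<subseteq> {..<d}"
      "snd ` set w' \<subseteq> {..<d}" "mul (act w (F (frame_tuple t))) (act w' (G (frame_tuple u))) \<noteq> 0"
    using link[OF F(2) G(2)] by blast
  define k where "k = length w"
  define k' where "k' = length w'"
  \<comment> \<open>The variables of \<open>G\<close> are moved behind those of \<open>F\<close>.\<close>
  define G1 where "G1 x = G (x \<circ> (\<lambda>i. n + i))" for x
  have img: "image_mset (\<lambda>i. n + i) (mset_set {..<m}) = mset_set {n..<n + m}"
    by (subst image_mset_mset_set) (auto simp: lessThan_atLeast0 image_add_atLeastLessThan)
  have G1: "G1 \<in> poly_maps (mset_set {n..<n + m})"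
    using poly_maps_rename[OF G(1), of "\<lambda>i. n + i"] unfolding img G1_def .
  obtain F' where F': "F' \<in> poly_maps (mset_set {..<n} + mset_set {n + m..<n + m + k})"
      "\<And>x. (\<forall>i<k. x (n + m + i) = e (snd (w ! i))) \<Longrightarrow> F' x = act w (F x)"
      "\<And>x. F x = 0 \<Longrightarrow> F' x = 0"
    using poly_maps_act[OF F(1), of "n + m" w] unfolding k_def by blast
  obtain G' where G': "G' \<in> poly_maps (mset_set {n..<n + m} +
        mset_set {n + m + k..<n + m + k + k'})"
      "\<And>x. (\<forall>i<k'. x (n + m + k + i) = e (snd (w' ! i))) \<Longrightarrow> G' x = act w' (G1 x)"
      "\<And>x. G1 x = 0 \<Longrightarrow> G' x = 0"
    using poly_maps_act[OF G1, of "n + m + k" w'] unfolding k'_def by blast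
  define H where "H x = mul (F' x) (G' x)" for x
  have sets: "{..<n + m + (k + k')} =
      ({..<n} \<union> {n + m..<n + m + k}) \<union> ({n..<n + m} \<union> {n + m + k..<n + m + k + k'})"
    by auto
  have vars: "mset_set {..<n + m + (k + k')} =
      (mset_set {..<n} + mset_set {n + m..<n + m + k}) +
      (mset_set {n..<n + m} + mset_set {n + m + k..<n + m + k + k'})"
    unfolding sets by (subst mset_set_Union; (subst mset_set_Union)?; auto)+
  have H: "H \<in> poly_maps (mset_set {..<n + m + (k + k')})"
    using poly_maps_mul[OF F'(1) G'(1)] unfolding vars H_def .
  have Fpre: "F (frame_tuple ((s @ q) @ v)) = F (frame_tuple s)" if "s \<in> frame_lists n" for s q v
    by (rule poly_maps_cong[OF F(1)]) (use that in \<open>auto simp: frame_lists_def nth_append\<close>)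
  have Gpre: "G1 (frame_tuple ((s @ q) @ v)) = G (frame_tuple q)" if "s \<in> frame_lists n" "q \<in> frame_lists m" for s q v
    unfolding G1_def
    by (rule poly_maps_cong[OF G(1)]) (use that in \<open>auto simp: frame_lists_def nth_append\<close>)
  let ?z = "map snd w @ map snd w'"
  have "\<exists>z\<in>frame_lists (k + k'). (t @ u) @ z \<in> pivot_lists (n + m + (k + k'))"
  proof (rule leading_extension[OF H])
    show "t @ u \<in> frame_lists (n + m)" using append_frame_lists[OF tn um] .
    show "?z \<in> frame_lists (k + k')" using w by (auto simp: frame_lists_def k_def k'_def)
    have len: "length t = n" "length u = m" using tn um by (auto simp: frame_lists_def)
    have "F' (frame_tuple ((t @ u) @ ?z)) = act w (F (frame_tuple ((t @ u) @ ?z)))"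
      by (rule F'(2)) (use len in \<open>auto simp: nth_append k_def\<close>)
    moreover have "G' (frame_tuple ((t @ u) @ ?z)) = act w' (G1 (frame_tuple ((t @ u) @ ?z)))"
      by (rule G'(2)) (use len in \<open>auto simp: nth_append k_def k'_def\<close>)
    ultimately show "H (frame_tuple ((t @ u) @ ?z)) \<noteq> 0"
      using w(5) Fpre[OF tn] Gpre[OF tn um] by (simp only: H_def) simp
    fix s v
    assume s: "s \<in> frame_lists (n + m)" "v \<in> frame_lists (k + k')" "map \<delta> s = map \<delta> (t @ u)" "s < t @ u"
    obtain p q where pq: "s = p @ q" "p \<in> frame_lists n" "q \<in> frame_lists m"
      using frame_lists_split[OF s(1)] .
    have lp: "length p = length t" using pq(2) len by (simp add: frame_lists_def)
    then have deg: "map \<delta> p = map \<delta> t" "map \<delta> q = map \<delta> u" using s(3) pq(1) by auto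
    have "p < t \<or> q < u"
      using s(4) append_less_append_iff[OF lp] pq(1) by auto
    then have "F (frame_tuple p) = 0 \<or> G (frame_tuple q) = 0"
      using F(3)[OF pq(2) deg(1)] G(3)[OF pq(3) deg(2)] by blast
    then show "H (frame_tuple (s @ v)) = 0"
      using F'(3)[of "frame_tuple (s @ v)"] G'(3)[of "frame_tuple (s @ v)"] Fpre[OF pq(2), of q v]
        Gpre[OF pq(2,3), of v] unfolding H_def pq(1) by auto
  qed
  then show ?thesis
    using w(1,2) unfolding k_def k'_def by (intro exI[of _ "k + k'"]) (auto simp: k_def k'_def)
qed

end

section \<open>Growth of the pivot lists of a simple algebra\<close>

context homogeneous_frame
begin

lemma pivot_lists_length: "t \<in> pivot_lists n \<Longrightarrow> length t = n"
  by (simp add: pivot_lists_def frame_lists_def)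

lemma span_frame_induct:
  assumes "subspace {y. P y}" "\<And>i. i < d \<Longrightarrow> P (e i)"
  shows "P y"
  using span_minimal[of "e ` {..<d}" "{y. P y}"] assms frame_span by auto

text \<open>The two-sided annihilator of a simple algebra with nonzero product is the zero ideal.\<close>

lemma frame_product_nonzero:
  assumes simple: "simple_algebra scale mul" and nontriv: "mul x0 y0 \<noteq> 0" and a: "a \<noteq> 0"
  shows "\<exists>i<d. mul (e i) a \<noteq> 0 \<or> mul a (e i) \<noteq> 0"
proof (rule ccontr)
  assume no: "\<not> ?thesis"
  define I where "I = {x. \<forall>y. mul x y = 0 \<and> mul y x = 0}"
  have "subspace I"
    by (auto simp: I_def subspace_def mul_add_left mul_add_right mul_scale_left mul_scale_right)
  then have "two_sided_ideal scale mul I"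
    unfolding two_sided_ideal_def by (auto simp: I_def)
  then have "I = {0} \<or> I = UNIV"
    using simple unfolding simple_algebra_def by blast
  moreover have "I \<noteq> UNIV"
    using nontriv by (auto simp: I_def)
  moreover have "mul a y = 0 \<and> mul y a = 0" for y
  proof (rule span_frame_induct[of "\<lambda>y. mul a y = 0 \<and> mul y a = 0"])
    show "subspace {y. mul a y = 0 \<and> mul y a = 0}"
      by (auto simp: subspace_def mul_add_left mul_add_right mul_scale_left mul_scale_right)
  qed (use no in auto)
  ultimately show False using a by (auto simp: I_def)
qed

text \<open>The spans of the images of \<open>a\<close> under words of length at most \<open>k\<close> form an increasing
  chain. Once two consecutive members agree, the chain is stationary at a nonzero ideal, and
  this happens no later than at the dimension. It matters that this bound \<open>N\<close> does not depend on
  \<open>a\<close>.\<close>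

lemma act_spans:
  assumes fin: "finite_dimensional_vector_space scale Basis" and simple: "simple_algebra scale mul"
  shows "\<exists>N. \<forall>a. a \<noteq> 0 \<longrightarrow> span {act w a | w. length w \<le> N \<and> snd ` set w \<subseteq> {..<d}} = UNIV"
proof -
  interpret finite_dimensional_vector_space scale Basis by (rule fin)
  have "span {act w a | w. length w \<le> dimension \<and> snd ` set w \<subseteq> {..<d}} = UNIV"
    if a: "a \<noteq> 0" for a
  proof -
    define I where "I k = span {act w a | w. length w \<le> k \<and> snd ` set w \<subseteq> {..<d}}" for k
    have gen: "act w a \<in> I k" if "length w \<le> k" "snd ` set w \<subseteq> {..<d}" for w k
      unfolding I_def using that by (intro span_base) blast
    have mono: "I k \<subseteq> I l" if "k \<le> l" for k l
      unfolding I_def by (intro span_mono) (use that in auto)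
    have sub: "subspace (I k)" for k by (simp add: I_def)
    have "\<exists>k\<le>dimension. I (Suc k) = I k"
    proof (rule ccontr)
      assume no: "\<not> ?thesis"
      have "k \<le> dim (I k)" if "k \<le> Suc dimension" for k
        using that
      proof (induction k)
        case (Suc k)
        have "I k \<subset> I (Suc k)" using mono[of k "Suc k"] no Suc.prems by auto
        then have "dim (I k) < dim (I (Suc k))"
          using dim_psubset[of "I k" "I (Suc k)"] span_eq_iff[THEN iffD2, OF sub] by simp
        then show ?case using Suc by simp
      qed simp
      from this[of "Suc dimension"] dim_subset_UNIV[of "I (Suc dimension)"] show False by simp
    qed
    then obtain k where k: "k \<le> dimension" "I (Suc k) = I k" by blast
    have step: "mul (e i) x \<in> I k \<and> mul x (e i) \<in> I k" if i: "i < d" and x: "x \<in> I k" for i x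
    proof -
      have "subspace {x. mul (e i) x \<in> I k \<and> mul x (e i) \<in> I k}"
        using sub[of k]
        by (auto simp: subspace_def mul_add_left mul_add_right mul_scale_left mul_scale_right)
      moreover have "mul (e i) (act w a) \<in> I k \<and> mul (act w a) (e i) \<in> I k"
        if "length w \<le> k" "snd ` set w \<subseteq> {..<d}" for w
        using gen[of "(True, i) # w" "Suc k"] gen[of "(False, i) # w" "Suc k"] that i k(2) by simp
      ultimately have "I k \<subseteq> {x. mul (e i) x \<in> I k \<and> mul x (e i) \<in> I k}"
        unfolding I_def[of k] by (intro span_minimal) (auto simp flip: I_def)
      then show ?thesis using x by blast
    qed
    have "mul y x \<in> I k \<and> mul x y \<in> I k" if x: "x \<in> I k" for x y
    proof (rule span_frame_induct[of "\<lambda>y. mul y x \<in> I k \<and> mul x y \<in> I k"])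
      show "subspace {y. mul y x \<in> I k \<and> mul x y \<in> I k}"
        using sub[of k]
        by (auto simp: subspace_def mul_add_left mul_add_right mul_scale_left mul_scale_right)
    qed (use step x in auto)
    then have "two_sided_ideal scale mul (I k)"
      unfolding two_sided_ideal_def using sub by blast
    moreover have "a \<in> I k" using gen[of "[]" k] by simp
    ultimately have "I k = UNIV" using simple a unfolding simple_algebra_def by blast
    then show ?thesis using mono[OF k(1)] unfolding I_def by blast
  qed
  then show ?thesis by blast
qed

text \<open>Otherwise the product would vanish on two spanning sets, hence identically.\<close>

lemma act_link:
  assumes span: "\<forall>a. a \<noteq> 0 \<longrightarrow> span {act w a | w. length w \<le> N \<and> snd ` set w \<subseteq> {..<d}} = UNIV"
    and nontriv: "mul x0 y0 \<noteq> 0" and ab: "a \<noteq> 0" "b \<noteq> 0"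
  shows "\<exists>w w'. length w \<le> N \<and> length w' \<le> N \<and> snd ` set w \<subseteq> {..<d} \<and>
    snd ` set w' \<subseteq> {..<d} \<and> mul (act w a) (act w' b) \<noteq> 0"
proof (rule ccontr)
  assume no: "\<not> ?thesis"
  let ?G = "\<lambda>a. {act w a | w. length w \<le> N \<and> snd ` set w \<subseteq> {..<d}}"
  have subl: "subspace {x. mul x y = 0}" and subr: "subspace {x. mul y x = 0}" for y
    by (auto simp: subspace_def mul_add_left mul_add_right mul_scale_left mul_scale_right)
  have 1: "mul x y = 0" if "x \<in> ?G a" for x y
  proof -
    have "?G b \<subseteq> {y. mul x y = 0}" using no that by auto
    then show ?thesis using span_minimal[OF _ subr, of "?G b" x] span ab by auto
  qed
  have "?G a \<subseteq> {x. mul x y0 = 0}" using 1 by auto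
  then show False using span_minimal[OF _ subl, of "?G a" y0] span ab nontriv by auto
qed

text \<open>The first two inequalities come from injections that append letters to lists of known
  length; the shift \<open>R\<close> is twice the bound on the length of words in \<open>act_spans\<close>.\<close>

theorem card_pivot_lists_growth:
  assumes fin: "finite_dimensional_vector_space scale Basis" and simple: "simple_algebra scale mul"
    and nontriv: "mul x0 y0 \<noteq> 0"
  obtains R where "\<And>n k. card (pivot_lists n) \<le> card (pivot_lists (n + k))"
    and "\<And>n m. card (pivot_lists n) * card (pivot_lists m) \<le> card (pivot_lists (n + m + R))"
    and "\<And>n. 1 \<le> n \<Longrightarrow> 1 \<le> card (pivot_lists n)"
proof -
  obtain N where N: "\<forall>a. a \<noteq> 0 \<longrightarrow> span {act w a | w. length w \<le> N \<and> snd ` set w \<subseteq> {..<d}} = UNIV"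
    using act_spans[OF fin simple] by blast
  have finP: "finite (pivot_lists n)" for n using pivot_lists_subset finite_frame_lists finite_subset by blast
  have ext: "\<exists>z\<in>frame_lists k. t @ z \<in> pivot_lists (n + k)" if "t \<in> pivot_lists n" for t n k
    using that
  proof (rule pivot_lists_extend_by_act)
    show "\<exists>w. length w = k \<and> snd ` set w \<subseteq> {..<d} \<and> act w a \<noteq> 0" if "a \<noteq> 0" for a
    proof (induction k)
      case 0
      then show ?case using that by auto
    next
      case (Suc k)
      then obtain w where w: "length w = k" "snd ` set w \<subseteq> {..<d}" "act w a \<noteq> 0" by blast
      obtain i where i: "i < d" "mul (e i) (act w a) \<noteq> 0 \<or> mul (act w a) (e i) \<noteq> 0"
        using frame_product_nonzero[OF simple nontriv w(3)] by blast
      then show ?case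
        using w by (intro exI[of _ "(mul (e i) (act w a) \<noteq> 0, i) # w"]) auto
    qed
  qed
  have mono: "card (pivot_lists n) \<le> card (pivot_lists (n + k))" for n k
  proof -
    obtain z where z: "\<And>t. t \<in> pivot_lists n \<Longrightarrow> t @ z t \<in> pivot_lists (n + k)"
      using ext[of _ n k] by metis
    show ?thesis
    proof (rule card_inj_on_le[of "\<lambda>t. t @ z t"])
      show "inj_on (\<lambda>t. t @ z t) (pivot_lists n)"
      proof (rule inj_onI)
        fix s t assume st: "s \<in> pivot_lists n" "t \<in> pivot_lists n" "s @ z s = t @ z t"
        have "length s = length t" using st(1,2)[THEN pivot_lists_length] by simp
        then show "s = t"
          using st(3) append_eq_append_conv[of s t "z s" "z t"] by blast
      qed
    qed (use z finP in auto)
  qed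
  have app: "\<exists>z. t @ u @ z \<in> pivot_lists (n + m + 2 * N)" if tu: "t \<in> pivot_lists n" "u \<in> pivot_lists m" for t u n m
  proof -
    obtain k z where k: "k \<le> 2 * N" "t @ u @ z \<in> pivot_lists (n + m + k)"
      using pivot_lists_append[OF tu act_link[OF N nontriv]] by blast
    \<comment> \<open>The length \<open>k\<close> depends on the pair; padding makes the total shift the same for all pairs.\<close>
    obtain z' where "(t @ u @ z) @ z' \<in> pivot_lists (n + m + k + (2 * N - k))"
      using ext[OF k(2), of "2 * N - k"] by blast
    moreover have "n + m + k + (2 * N - k) = n + m + 2 * N" using k(1) by simp
    ultimately have "t @ u @ (z @ z') \<in> pivot_lists (n + m + 2 * N)" by simp
    then show ?thesis by blast
  qed
  have super: "card (pivot_lists n) * card (pivot_lists m) \<le> card (pivot_lists (n + m + 2 * N))" for n m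
  proof -
    obtain z where z: "\<And>t u. t \<in> pivot_lists n \<Longrightarrow> u \<in> pivot_lists m \<Longrightarrow> t @ u @ z t u \<in> pivot_lists (n + m + 2 * N)"
      using app[of _ n _ m] by metis
    have "card (pivot_lists n \<times> pivot_lists m) \<le> card (pivot_lists (n + m + 2 * N))"
    proof (rule card_inj_on_le[of "\<lambda>(t, u). t @ u @ z t u"])
      show "inj_on (\<lambda>(t, u). t @ u @ z t u) (pivot_lists n \<times> pivot_lists m)"
      proof (rule inj_onI, clarsimp)
        fix s q t u
        assume st: "s \<in> pivot_lists n" "t \<in> pivot_lists n" and qu: "q \<in> pivot_lists m" "u \<in> pivot_lists m"
          and eq: "s @ q @ z s q = t @ u @ z t u"
        have "length s = length t" "length q = length u"
          using st[THEN pivot_lists_length] qu[THEN pivot_lists_length] by simp_all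
        then show "s = t \<and> q = u"
          using eq append_eq_append_conv[of s t] append_eq_append_conv[of q u] by blast
      qed
    qed (use z finP in auto)
    then show ?thesis by (simp add: card_cartesian_product)
  qed
  have "1 \<le> card (pivot_lists 1)"
  proof -
    obtain i where i: "i < d" "e i \<noteq> 0"
      using frame_product_nonzero[OF simple nontriv, of x0] nontriv by fastforce
    \<comment> \<open>The polynomial in a single variable already has a pivot.\<close>
    have "\<exists>z\<in>frame_lists 1. [] @ z \<in> pivot_lists (0 + 1)"
      by (rule leading_extension[of "\<lambda>a. a 0" 0 1 "[]" "[i]"])
        (use poly_maps_var[of 0] i in \<open>auto simp: frame_lists_def lessThan_Suc\<close>)
    then have "pivot_lists 1 \<noteq> {}" by auto
    then show ?thesis using finP[of 1] by (simp add: Suc_le_eq card_gt_0_iff)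
  qed
  then have "1 \<le> card (pivot_lists n)" if "1 \<le> n" for n
    using mono[of 1 "n - 1"] that by simp
  then show ?thesis using that[of "2 * N"] mono super by blast
qed

end

section \<open>Graded codimensions and pivot lists\<close>

text \<open>Positions in a list \<open>\<phi>\<close> of degrees correspond to the variables of the multilinear
  polynomials with content \<open>\<phi>\<close>: equal degrees are numbered consecutively.\<close>

lemma exists_position_bijection:
  "\<exists>\<beta>. bij_betw \<beta> {..<length \<phi>} {(g, j). j < count (mset \<phi>) g} \<and> (\<forall>i<length \<phi>. fst (\<beta> i) = \<phi> ! i)"
proof (induction \<phi> rule: rev_induct)
  case Nil
  then show ?case by (simp add: bij_betw_def)
next
  case (snoc x \<phi>)
  then obtain \<beta> where \<beta>: "bij_betw \<beta> {..<length \<phi>} {(g, j). j < count (mset \<phi>) g}"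
      "\<forall>i<length \<phi>. fst (\<beta> i) = \<phi> ! i"
    by blast
  define \<beta>' where "\<beta>' = \<beta>(length \<phi> := (x, count (mset \<phi>) x))"
  let ?X = "{(g, j). j < count (mset \<phi>) g}"
  have last: "\<beta>' (length \<phi>) = (x, count (mset \<phi>) x)" by (simp add: \<beta>'_def)
  have "\<beta> i = \<beta>' i" if "i \<in> {..<length \<phi>}" for i using that by (simp add: \<beta>'_def)
  then have "bij_betw \<beta>' {..<length \<phi>} ?X"
    using \<beta>(1) bij_betw_cong by blast
  then have "bij_betw \<beta>' ({..<length \<phi>} \<union> {length \<phi>}) (?X \<union> {\<beta>' (length \<phi>)})"
    by (intro notIn_Un_bij_betw) (auto simp: last)
  moreover have "?X \<union> {\<beta>' (length \<phi>)} = {(g, j). j < count (mset (\<phi> @ [x])) g}"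
    unfolding last by (auto simp: less_Suc_eq split: if_splits)
  moreover have "{..<length \<phi>} \<union> {length \<phi>} = {..<length (\<phi> @ [x])}" by auto
  ultimately have "bij_betw \<beta>' {..<length (\<phi> @ [x])} {(g, j). j < count (mset (\<phi> @ [x])) g}"
    by (simp only:)
  moreover have "fst (\<beta>' i) = (\<phi> @ [x]) ! i" if "i < length (\<phi> @ [x])" for i
  proof (cases "i = length \<phi>")
    case False
    then show ?thesis using that \<beta>(2) by (simp add: \<beta>'_def nth_append)
  qed (simp add: last)
  ultimately show ?case by blast
qed

context homogeneous_frame
begin

text \<open>Renaming variables by positions turns the polynomials in question into the maps that
  define pivot lists; the identities among them are the polynomials vanishing at all frame
  tuples of degrees \<open>\<phi>\<close>.\<close>

theorem partial_codim_bounds: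
  assumes len: "length \<phi> = n"
  defines "P \<equiv> {t\<in>pivot_lists n. map \<delta> t = \<phi>}"
  shows "card P \<le> partial_codim scale mul A (count (mset \<phi>))"
    and "partial_codim scale mul A (count (mset \<phi>)) \<le> d * card P"
proof -
  define X where "X = {(g, j). j < count (mset \<phi>) g}"
  obtain \<beta> where \<beta>: "bij_betw \<beta> {..<n} X" "\<And>i. i < n \<Longrightarrow> fst (\<beta> i) = \<phi> ! i"
    using exists_position_bijection[of \<phi>] len unfolding X_def by blast
  define \<gamma> where "\<gamma> = inv_into {..<n} \<beta>"
  have \<gamma>: "bij_betw \<gamma> X {..<n}"
    unfolding \<gamma>_def by (rule bij_betw_inv_into[OF \<beta>(1)])
  have \<gamma>\<beta>: "\<gamma> (\<beta> i) = i" "\<beta> i \<in> X" if "i < n" for i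
    using \<beta>(1) that by (auto simp: \<gamma>_def bij_betw_def)
  have \<beta>\<gamma>: "\<beta> (\<gamma> x) = x" "\<gamma> x < n" if "x \<in> X" for x
    using \<beta>(1) \<gamma> that by (auto simp: \<gamma>_def bij_betw_def f_inv_into_f)
  have finX: "finite X" using \<beta>(1) bij_betw_finite by blast
  have img: "image_mset \<gamma> (mset_set X) = mset_set {..<n}" "image_mset \<beta> (mset_set {..<n}) = mset_set X"
    using \<beta>(1) \<gamma> by (auto simp: bij_betw_def image_mset_mset_set)
  define V :: "('g \<times> nat, 'f) free_alg set" where "V = polys_with_vars (mset_set X)"
  have V: "multilinear_polys (count (mset \<phi>)) = V"
    by (simp add: multilinear_polys_def polys_with_vars_def V_def X_def)
  have evV: "(\<lambda>a. eval_poly scale mul a v) \<in> poly_maps (mset_set X)" if "v \<in> V" for v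
    using that unfolding poly_maps_def V_def by blast
  define T where "T = {t\<in>frame_lists n. map \<delta> t = \<phi>}"
  \<comment> \<open>The polynomials are evaluated at the frame tuple \<open>t\<close>; variables outside \<open>X\<close> get the value 0,
    which is homogeneous of every degree.\<close>
  define asg where "asg t x = (if x \<in> X then e (t ! \<gamma> x) else 0)" for t x
  define ev where "ev t = eval_poly scale mul (asg t)" for t
  have asg_graded: "asg t (g, j) \<in> A g" if t: "t \<in> T" for t g j
  proof (cases "(g, j) \<in> X")
    case True
    define i where "i = \<gamma> (g, j)"
    have i: "i < n" "\<beta> i = (g, j)" using \<beta>\<gamma>[OF True] by (auto simp: i_def)
    then have "\<delta> (t ! i) = g" "t ! i < d"
      using \<beta>(2)[OF i(1)] t by (auto simp: T_def frame_lists_def subset_iff)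
    then show ?thesis using frame_component[of "t ! i"] True by (simp add: asg_def i_def)
  qed (use subspace_0[OF subspace_component] in \<open>simp add: asg_def\<close>)
  have W: "V \<inter> graded_identities scale mul A = {v\<in>V. \<forall>t\<in>T. ev t v = 0}"
  proof (intro set_eqI iffI)
    fix v assume "v \<in> V \<inter> graded_identities scale mul A"
    then show "v \<in> {v\<in>V. \<forall>t\<in>T. ev t v = 0}"
      using asg_graded by (auto simp: graded_identities_def ev_def)
  next
    fix v assume v: "v \<in> {v\<in>V. \<forall>t\<in>T. ev t v = 0}"
    have "eval_poly scale mul a v = 0" if a: "\<forall>g j. a (g, j) \<in> A g" for a
    proof (rule poly_maps_eq_zero_if_spanning[where F = "\<lambda>a. eval_poly scale mul a v" and
        S = "\<lambda>x. e ` {i. i < d \<and> \<delta> i = fst x}"])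
      show F: "(\<lambda>a. eval_poly scale mul a v) \<in> poly_maps (mset_set X)" using evV v by blast
      show "count (mset_set X) x = 1" if "x \<in># mset_set X" for x using that finX by simp
      show "a x \<in> span (e ` {i. i < d \<and> \<delta> i = fst x})" for x
        using a component_span[of "fst x"] by (cases x) auto
      fix b :: "'g \<times> nat \<Rightarrow> 'a"
      assume b: "\<And>x. x \<in># mset_set X \<Longrightarrow> b x \<in> e ` {i. i < d \<and> \<delta> i = fst x}"
      then have "\<forall>x\<in>X. \<exists>k. k < d \<and> \<delta> k = fst x \<and> b x = e k" using finX by fastforce
      then obtain k where k: "\<And>x. x \<in> X \<Longrightarrow> k x < d" "\<And>x. x \<in> X \<Longrightarrow> \<delta> (k x) = fst x"
          "\<And>x. x \<in> X \<Longrightarrow> b x = e (k x)"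
        by metis
      define t where "t = map (\<lambda>i. k (\<beta> i)) [0..<n]"
      have "map \<delta> t = \<phi>"
        by (rule nth_equalityI) (use k(2) \<beta>(2) \<gamma>\<beta>(2) len in \<open>auto simp: t_def\<close>)
      moreover have "k (\<beta> i) < d" if "i < n" for i using k(1)[OF \<gamma>\<beta>(2)[OF that]] .
      then have "t \<in> frame_lists n" by (auto simp: frame_lists_def t_def)
      ultimately have "ev t v = 0" using v by (simp add: T_def)
      moreover have "eval_poly scale mul b v = eval_poly scale mul (asg t) v"
        by (rule poly_maps_cong[OF F]) (use finX k(3) \<beta>\<gamma> in \<open>auto simp: asg_def t_def\<close>)
      ultimately show "eval_poly scale mul b v = 0" by (simp add: ev_def)
    qed
    then show "v \<in> V \<inter> graded_identities scale mul A"
      using v by (auto simp: graded_identities_def)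
  qed
  have "pivots V ev T = P"
  proof (intro set_eqI iffI)
    fix t assume "t \<in> pivots V ev T"
    then obtain v where t: "t \<in> T" and v: "v \<in> V" "ev t v \<noteq> 0"
        "\<And>s. s \<in> T \<Longrightarrow> s < t \<Longrightarrow> ev s v = 0"
      unfolding pivots_def by blast
    define F where "F x = eval_poly scale mul (x \<circ> \<gamma>) v" for x
    have F: "F \<in> poly_maps (mset_set {..<n})"
      using poly_maps_rename[OF evV[OF v(1)], of \<gamma>] unfolding img F_def .
    have "F (frame_tuple s) = ev s v" for s
      unfolding F_def ev_def
      by (rule poly_maps_cong[OF evV[OF v(1)]]) (use finX in \<open>auto simp: asg_def\<close>)
    then have "F (frame_tuple t) \<noteq> 0 \<and> (\<forall>s\<in>frame_lists n. map \<delta> s = map \<delta> t \<longrightarrow> s < t \<longrightarrow> F (frame_tuple s) = 0)"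
      using t v(2,3) by (simp add: T_def)
    then show "t \<in> P" using F t unfolding P_def pivot_lists_def T_def by blast
  next
    fix t assume tP: "t \<in> P"
    then have t: "t \<in> T" by (auto simp: P_def pivot_lists_def T_def)
    obtain F where F: "F \<in> poly_maps (mset_set {..<n})" "F (frame_tuple t) \<noteq> 0"
      "\<And>s. s \<in> frame_lists n \<Longrightarrow> map \<delta> s = map \<delta> t \<Longrightarrow> s < t \<Longrightarrow> F (frame_tuple s) = 0"
      using tP unfolding P_def pivot_lists_def by blast
    have "(\<lambda>x. F (x \<circ> \<beta>)) \<in> poly_maps (mset_set X)"
      using poly_maps_rename[OF F(1), of \<beta>] unfolding img .
    then obtain v where v: "v \<in> V" "(\<lambda>x. F (x \<circ> \<beta>)) = (\<lambda>x. eval_poly scale mul x v)"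
      unfolding poly_maps_def V_def by blast
    have "ev s v = F (frame_tuple s)" for s
    proof -
      have "ev s v = F (asg s \<circ> \<beta>)" using fun_cong[OF v(2), of "asg s"] by (simp add: ev_def)
      also have "\<dots> = F (frame_tuple s)"
        by (rule poly_maps_cong[OF F(1)]) (use \<gamma>\<beta> in \<open>auto simp: asg_def\<close>)
      finally show ?thesis .
    qed
    then have "ev t v \<noteq> 0 \<and> (\<forall>s\<in>T. s < t \<longrightarrow> ev s v = 0)"
      using t F(2,3) by (simp add: T_def)
    then show "t \<in> pivots V ev T" using t v(1) unfolding pivots_def by blast
  qed
  moreover interpret free: vector_space free_scale by (rule vector_space_free_scale)
  interpret vector_space_pair free_scale scale by unfold_locales
  have "finite T" using finite_frame_lists by (simp add: T_def)
  moreover have "free.subspace V"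
    unfolding free.subspace_def
  proof (intro conjI ballI allI)
    fix f g c assume f: "f \<in> V" and g: "g \<in> V"
    show "f + g \<in> V"
      using f g keys_add[of f g] unfolding V_def polys_with_vars_def by blast
    have "Poly_Mapping.keys (free_scale c f) \<subseteq> Poly_Mapping.keys f"
      by (auto simp: in_keys_iff lookup_free_scale)
    then show "free_scale c f \<in> V" using f unfolding V_def polys_with_vars_def by blast
  qed (simp add: V_def polys_with_vars_def)
  ultimately have bounds: "card P \<le> quotient_dim free_scale V {v\<in>V. \<forall>t\<in>T. ev t v = 0}"
      "quotient_dim free_scale V {v\<in>V. \<forall>t\<in>T. ev t v = 0} \<le> card (e ` {..<d}) * card P"
    using pivots_quotient_dim[of T V ev "e ` {..<d}"] linear_eval_poly frame_span
    by (auto simp: ev_def)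
  show "card P \<le> partial_codim scale mul A (count (mset \<phi>))"
    unfolding partial_codim_def V W by (rule bounds(1))
  have "card (e ` {..<d}) * card P \<le> d * card P"
    using mult_le_mono1[OF card_image_le[of "{..<d}" e]] by simp
  then show "partial_codim scale mul A (count (mset \<phi>)) \<le> d * card P"
    unfolding partial_codim_def V W using bounds(2) by (rule order_trans[rotated])
qed

end

text \<open>The multinomial coefficient of \<open>\<nu>\<close> counts the lists in which each \<open>g\<close> occurs \<open>\<nu> g\<close> times.\<close>

lemma sum_multinomial_eq_sum_lists:
  fixes q :: "('g \<Rightarrow> nat) \<Rightarrow> nat"
  assumes S: "finite S"
  shows "(\<Sum>\<nu>\<in>degree_tuples S n. multinomial S \<nu> * q \<nu>) =
    (\<Sum>\<phi> | set \<phi> \<subseteq> S \<and> length \<phi> = n. q (count (mset \<phi>)))"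
proof -
  let ?L = "{\<phi>. set \<phi> \<subseteq> S \<and> length \<phi> = n}"
  have finL: "finite ?L" by (rule finite_lists_length_eq[OF S])
  have size: "size M = (\<Sum>g\<in>S. count M g)" if "set_mset M \<subseteq> S" for M
    unfolding size_multiset_overloaded_eq
    by (rule sum.mono_neutral_left) (use S that in \<open>auto simp: count_eq_zero_iff\<close>)
  have cnt: "count (mset \<phi>) \<in> degree_tuples S n" if "\<phi> \<in> ?L" for \<phi>
    using that size[of "mset \<phi>"] by (auto simp: degree_tuples_def count_eq_zero_iff)
  have ms: "\<exists>M. \<nu> = count M \<and> set_mset M \<subseteq> S \<and> size M = n" if \<nu>: "\<nu> \<in> degree_tuples S n" for \<nu>
  proof -
    have "{g. 0 < \<nu> g} \<subseteq> S" using \<nu> by (auto simp: degree_tuples_def)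
    then have c: "count (Abs_multiset \<nu>) = \<nu>"
      using S by (intro count_Abs_multiset) (auto intro: finite_subset)
    then have "set_mset (Abs_multiset \<nu>) \<subseteq> S"
      using \<open>{g. 0 < \<nu> g} \<subseteq> S\<close> by (auto simp: set_mset_def)
    then show ?thesis
      using size[of "Abs_multiset \<nu>"] c \<nu> by (intro exI[of _ "Abs_multiset \<nu>"]) (auto simp: degree_tuples_def)
  qed
  have fiber: "(\<Sum>\<phi> | \<phi> \<in> ?L \<and> count (mset \<phi>) = \<nu>. q (count (mset \<phi>))) = multinomial S \<nu> * q \<nu>"
    if \<nu>: "\<nu> \<in> degree_tuples S n" for \<nu>
  proof -
    obtain M where M: "\<nu> = count M" "set_mset M \<subseteq> S" "size M = n" using ms[OF \<nu>] by blast
    have "\<phi> \<in> ?L" if "mset \<phi> = M" for \<phi>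
      using M(2,3) that by auto
    then have "{\<phi>. \<phi> \<in> ?L \<and> count (mset \<phi>) = \<nu>} = permutations_of_multiset M"
      unfolding permutations_of_multiset_def M(1) count_inject by blast
    moreover have "(\<Prod>x\<in>set_mset M. fact (count M x)) = (\<Prod>x\<in>S. fact (count M x) :: nat)"
      by (rule prod.mono_neutral_left) (use S M in \<open>auto simp: not_in_iff\<close>)
    ultimately have "card {\<phi>. \<phi> \<in> ?L \<and> count (mset \<phi>) = \<nu>} = multinomial S \<nu>"
      using card_permutations_of_multiset(1)[of M] size[OF M(2)]
      by (simp add: multinomial_def M(1))
    then show ?thesis by simp
  qed
  have "degree_tuples S n \<subseteq> (\<lambda>\<phi>. count (mset \<phi>)) ` ?L"
  proof
    fix \<nu> assume "\<nu> \<in> degree_tuples S n"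
    then obtain M where M: "\<nu> = count M" "set_mset M \<subseteq> S" "size M = n" using ms by blast
    obtain \<phi> where "mset \<phi> = M" using ex_mset by blast
    then show "\<nu> \<in> (\<lambda>\<phi>. count (mset \<phi>)) ` ?L"
      using M by (intro image_eqI[of _ _ \<phi>]) auto
  qed
  then have "finite (degree_tuples S n)" using finL finite_surj by blast
  then have "(\<Sum>\<nu>\<in>degree_tuples S n. \<Sum>\<phi> | \<phi> \<in> ?L \<and> count (mset \<phi>) = \<nu>. q (count (mset \<phi>))) =
      (\<Sum>\<phi>\<in>?L. q (count (mset \<phi>)))"
    using cnt by (intro sum.group finL) auto
  moreover have "(\<Sum>\<nu>\<in>degree_tuples S n. multinomial S \<nu> * q \<nu>) =
      (\<Sum>\<nu>\<in>degree_tuples S n. \<Sum>\<phi> | \<phi> \<in> ?L \<and> count (mset \<phi>) = \<nu>. q (count (mset \<phi>)))"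
    by (intro sum.cong refl fiber[symmetric])
  ultimately show ?thesis by simp
qed

context homogeneous_frame
begin

theorem graded_codim_bounds:
  shows "card (pivot_lists n) \<le> graded_codim scale mul A n"
    and "graded_codim scale mul A n \<le> d * card (pivot_lists n)"
proof -
  let ?L = "{\<phi>. set \<phi> \<subseteq> Supp A \<and> length \<phi> = n}"
  have codim: "graded_codim scale mul A n = (\<Sum>\<phi>\<in>?L. partial_codim scale mul A (count (mset \<phi>)))"
    unfolding graded_codim_def by (rule sum_multinomial_eq_sum_lists[OF finite_Supp])
  have "finite (pivot_lists n)" using pivot_lists_subset finite_frame_lists finite_subset by blast
  moreover have "finite ?L" using finite_lists_length_eq[OF finite_Supp] .
  moreover have "map \<delta> ` pivot_lists n \<subseteq> ?L"
    using pivot_lists_subset[of n] frame_degree by (fastforce simp: frame_lists_def)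
  ultimately have "(\<Sum>\<phi>\<in>?L. \<Sum>t | t \<in> pivot_lists n \<and> map \<delta> t = \<phi>. 1) = (\<Sum>t\<in>pivot_lists n. 1 :: nat)"
    by (rule sum.group)
  then have card: "card (pivot_lists n) = (\<Sum>\<phi>\<in>?L. card {t\<in>pivot_lists n. map \<delta> t = \<phi>})"
    by simp
  show "card (pivot_lists n) \<le> graded_codim scale mul A n"
    unfolding codim card by (intro sum_mono partial_codim_bounds) auto
  show "graded_codim scale mul A n \<le> d * card (pivot_lists n)"
    unfolding codim card sum_distrib_left by (intro sum_mono partial_codim_bounds) auto
qed

end

section \<open>Roots of supermultiplicative sequences\<close>

text \<open>Fekete's argument with a shift. Dividing \<open>ln (p m)\<close> by \<open>m + R\<close> instead of \<open>m\<close> absorbs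
  the shift: cutting \<open>n\<close> into blocks of length \<open>m + R\<close> gives \<open>p n \<ge> p m ^ (n div (m + R) - 1)\<close>
  for \<open>n \<ge> m + R\<close>. The supremum \<open>L\<close> of these quotients is therefore the limit of \<open>ln (p n) / n\<close>,
  and the factor \<open>d\<close> between \<open>p\<close> and \<open>c\<close> disappears under the \<open>n\<close>-th root.\<close>

lemma root_convergent_if_supermultiplicative:
  fixes p c :: "nat \<Rightarrow> nat"
  assumes pos: "\<And>n. 1 \<le> n \<Longrightarrow> 1 \<le> p n"
    and mono: "\<And>n k. p n \<le> p (n + k)"
    and super: "\<And>n m. p n * p m \<le> p (n + m + R)"
    and bound: "\<And>n. p n \<le> d ^ n"
    and lower: "\<And>n. p n \<le> c n" and upper: "\<And>n. c n \<le> d * p n"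
  shows "convergent (\<lambda>n. root n (real (c n)))"
proof -
  define l where "l n = ln (real (p n))" for n
  have d: "1 \<le> d" using pos[of 1] bound[of 1] by simp
  have l_nonneg: "0 \<le> l n" if "1 \<le> n" for n
    using pos[OF that] by (simp add: l_def)
  have l_mono: "l n \<le> l (n + k)" if "1 \<le> n" for n k
    using pos[OF that] mono[of n k] by (simp add: l_def)
  have l_super: "l n + l m \<le> l (n + m + R)" if "1 \<le> n" "1 \<le> m" for n m
  proof -
    have "0 < real (p n)" "0 < real (p m)" using pos that by fastforce+
    then have "l n + l m = ln (real (p n * p m))" by (simp add: l_def ln_mult)
    also have "\<dots> \<le> l (n + m + R)"
      unfolding l_def using super[of n m] pos[of "n + m + R"] that \<open>0 < real (p n)\<close> \<open>0 < real (p m)\<close>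
      by (subst ln_le_cancel_iff) (auto simp flip: of_nat_mult)
    finally show ?thesis .
  qed
  have l_bound: "l n \<le> real n * ln (real d)" if "1 \<le> n" for n
  proof -
    have "l n \<le> ln (real d ^ n)"
      unfolding l_def using pos[OF that] bound[of n] d
      by (subst ln_le_cancel_iff) (auto simp flip: of_nat_power)
    then show ?thesis using d by (simp add: ln_realpow)
  qed
  have l_iter: "real q * l m \<le> l (Suc q * (m + R))" if m: "1 \<le> m" for q m
  proof (induction q)
    case 0
    then show ?case using l_nonneg m by simp
  next
    case (Suc q)
    have "real (Suc q) * l m \<le> l (Suc q * (m + R)) + l m"
      using Suc by (simp add: algebra_simps)
    also have "\<dots> \<le> l (Suc q * (m + R) + m + R)" using m by (intro l_super) auto
    finally show ?case by (simp add: algebra_simps)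
  qed
  define y where "y m = l m / real (m + R)" for m
  define L where "L = (SUP m\<in>{1..}. y m)"
  have bdd: "bdd_above (y ` {1..})"
  proof (rule bdd_aboveI2)
    fix m :: nat assume "m \<in> {1..}"
    then have m: "1 \<le> m" by simp
    have "l m \<le> real (m + R) * ln (real d)"
      using l_bound[OF m] d by (smt (verit) ln_ge_zero mult_right_mono of_nat_mono of_nat_1 le_add1)
    then show "y m \<le> ln (real d)" using m by (simp add: y_def field_simps)
  qed
  have y_le: "y m \<le> L" if "1 \<le> m" for m
    unfolding L_def using that by (intro cSUP_upper bdd) auto
  have low: "y m - 2 * l m / real n \<le> l n / real n" if m: "1 \<le> m" and n: "m + R \<le> n" for m n
  proof -
    let ?q = "n div (m + R)"
    have q: "1 \<le> ?q" using m n by (simp add: Suc_le_eq div_greater_zero_iff)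
    have "n < (?q + 1) * (m + R)"
      using m dividend_less_div_times[of "m + R" n] by (simp add: algebra_simps)
    then have "real n < (real ?q + 1) * real (m + R)"
      by (metis of_nat_1 of_nat_add of_nat_less_iff of_nat_mult)
    then have "real n / real (m + R) - 2 \<le> real (?q - 1)"
      using m q by (simp add: field_simps of_nat_diff)
    then have "(real n / real (m + R) - 2) * l m \<le> real (?q - 1) * l m"
      using l_nonneg[OF m] by (rule mult_right_mono)
    also have "\<dots> \<le> l (Suc (?q - 1) * (m + R))" by (rule l_iter[OF m])
    also have "Suc (?q - 1) = ?q" using q by simp
    also have "l (?q * (m + R)) \<le> l (?q * (m + R) + n mod (m + R))"
      using q m by (intro l_mono) simp
    also have "?q * (m + R) + n mod (m + R) = n" by (rule div_mult_mod_eq)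
    finally have "real n * y m - 2 * l m \<le> l n" by (simp add: y_def algebra_simps)
    then have "(real n * y m - 2 * l m) / real n \<le> l n / real n"
      by (intro divide_right_mono) auto
    then show ?thesis using m n by (simp add: diff_divide_distrib)
  qed
  have lim: "(\<lambda>n. l n / real n) \<longlonglongrightarrow> L"
  proof (rule order_tendstoI)
    fix a assume "a < L"
    then obtain m where m: "1 \<le> m" "a < y m"
      unfolding L_def using less_cSUP_iff[OF _ bdd] by auto
    have "(\<lambda>n. y m - 2 * l m / real n) \<longlonglongrightarrow> y m - 0"
      by (intro tendsto_diff tendsto_const lim_const_over_n)
    then have "\<forall>\<^sub>F n in sequentially. a < y m - 2 * l m / real n"
      using m(2) by (intro order_tendstoD) auto
    then show "\<forall>\<^sub>F n in sequentially. a < l n / real n"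
      using eventually_ge_at_top[of "m + R"]
      by eventually_elim (use low[OF m(1)] in fastforce)
  next
    fix a assume a: "L < a"
    have "(\<lambda>n. L + L * real R / real n) \<longlonglongrightarrow> L + 0"
      by (intro tendsto_add tendsto_const lim_const_over_n)
    then have "\<forall>\<^sub>F n in sequentially. L + L * real R / real n < a"
      using a by (intro order_tendstoD) auto
    then show "\<forall>\<^sub>F n in sequentially. l n / real n < a"
      using eventually_ge_at_top[of 1]
    proof eventually_elim
      case (elim n)
      have "l n \<le> L * real (n + R)"
        using y_le[OF elim(2)] elim(2) by (simp add: y_def field_simps)
      then have "l n / real n \<le> L + L * real R / real n"
        using elim(2) by (simp add: field_simps)
      then show ?case using elim(1) by simp
    qed
  qed
  have root_p: "root n (real (p n)) = exp (l n / real n)" if "1 \<le> n" for n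
    using pos[OF that] that
    by (simp add: l_def root_powr_inverse powr_def divide_inverse mult.commute)
  have lim_p: "(\<lambda>n. root n (real (p n))) \<longlonglongrightarrow> exp L"
    by (rule Lim_transform_eventually[OF tendsto_exp[OF lim]])
      (use eventually_ge_at_top[of 1] in \<open>eventually_elim, simp add: root_p\<close>)
  have "(\<lambda>n. root n (real (c n))) \<longlonglongrightarrow> exp L"
  proof (rule tendsto_sandwich[OF _ _ lim_p])
    show "\<forall>\<^sub>F n in sequentially. root n (real (p n)) \<le> root n (real (c n))"
      using eventually_ge_at_top[of 1] by eventually_elim (use lower in simp)
    show "\<forall>\<^sub>F n in sequentially. root n (real (c n)) \<le> root n (real d) * root n (real (p n))"
      using eventually_ge_at_top[of 1]
    proof eventually_elim
      case (elim n)
      have "root n (real (c n)) \<le> root n (real (d * p n))"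
        using elim upper[of n] by (intro real_root_le_mono of_nat_mono) auto
      then show ?case by (simp add: real_root_mult)
    qed
    show "(\<lambda>n. root n (real d) * root n (real (p n))) \<longlonglongrightarrow> exp L"
      using tendsto_mult[OF LIMSEQ_root_const lim_p, of "real d"] d by simp
  qed
  then show ?thesis by (auto simp: convergent_def)
qed

section \<open>Existence of homogeneous frames\<close>

text \<open>The given family and the zero family both decompose the zero vector.\<close>

lemma (in graded_algebra) homogeneous_sum_eq_zero:
  assumes G: "finite G" and c: "\<And>g. g \<in> G \<Longrightarrow> c g \<in> A g" and sum: "(\<Sum>g\<in>G. c g) = 0"
    and g: "g \<in> G"
  shows "c g = 0"
proof -
  define c' where "c' g = (if g \<in> G then c g else 0)" for g
  have supp: "{g. c' g \<noteq> 0} \<subseteq> G" by (auto simp: c'_def)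
  have "(\<Sum>g | c' g \<noteq> 0. c' g) = (\<Sum>g\<in>G. c' g)"
    using G supp by (intro sum.mono_neutral_left) auto
  also have "\<dots> = 0" using sum by (simp add: c'_def)
  finally have sum0: "0 = (\<Sum>g | c' g \<noteq> 0. c' g)" by (rule sym)
  let ?P = "\<lambda>c. (\<forall>g. c g \<in> A g) \<and> finite {g. c g \<noteq> 0} \<and> 0 = (\<Sum>g | c g \<noteq> 0. c g)"
  have "\<exists>\<^sub>\<le>\<^sub>1c. ?P c"
    using direct_sum[of 0] unfolding ex1_iff_ex_Uniq by (rule conjunct2)
  moreover have "?P c'"
    using c sum0 finite_subset[OF supp G] subspace_0[OF subspace_component] by (simp add: c'_def)
  moreover have "?P (\<lambda>_. 0)"
    using subspace_0[OF subspace_component] by simp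
  ultimately have "c' = (\<lambda>_. 0)" by (rule Uniq_D[of ?P])
  then have "c' g = 0" by simp
  then show ?thesis using g by (simp add: c'_def)
qed

text \<open>Nonzero vectors from different components are independent, so their number is bounded by the
  dimension.\<close>

lemma (in graded_algebra) finite_Supp_if_finite_dimensional:
  assumes "finite_dimensional_vector_space scale Basis"
  shows "finite (Supp A)"
proof (rule ccontr)
  interpret finite_dimensional_vector_space scale Basis by (rule assms)
  assume "infinite (Supp A)"
  then obtain G where G: "G \<subseteq> Supp A" "finite G" "card G = Suc (card Basis)"
    using infinite_arbitrarily_large by blast
  have "\<exists>v. v \<in> A g \<and> v \<noteq> 0" if "g \<in> G" for g
    using that G(1) subspace_0[OF subspace_component, of g] by (auto simp: Supp_def)
  then obtain v where v: "\<And>g. g \<in> G \<Longrightarrow> v g \<in> A g" "\<And>g. g \<in> G \<Longrightarrow> v g \<noteq> 0" by metis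
  have "\<forall>x. \<exists>r. x = (\<Sum>b\<in>Basis. scale (r b) b)"
    using span_finite[OF finite_Basis] span_Basis by (auto simp: image_iff)
  then obtain r where r: "\<And>x. x = (\<Sum>b\<in>Basis. scale (r x b) b)" by metis
  obtain u where u: "\<exists>g\<in>G. u g \<noteq> 0" "\<forall>b\<in>Basis. (\<Sum>g\<in>G. u g * r (v g) b) = 0"
    using homogeneous_system_nontrivial[OF finite_Basis G(2), of "\<lambda>g. r (v g)"] G(3) by auto
  have "(\<Sum>g\<in>G. scale (u g) (v g)) = (\<Sum>g\<in>G. scale (u g) (\<Sum>b\<in>Basis. scale (r (v g) b) b))"
    using r by simp
  also have "\<dots> = (\<Sum>b\<in>Basis. \<Sum>g\<in>G. scale (u g * r (v g) b) b)"
    by (subst sum.swap) (simp add: scale_sum_right)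
  also have "\<dots> = (\<Sum>b\<in>Basis. scale (\<Sum>g\<in>G. u g * r (v g) b) b)"
    by (simp add: scale_sum_left)
  also have "\<dots> = 0" using u(2) by simp
  finally have "scale (u g) (v g) = 0" if "g \<in> G" for g
    using that by (intro homogeneous_sum_eq_zero[OF G(2), of "\<lambda>g. scale (u g) (v g)"]
        subspace_scale[OF subspace_component] v) auto
  then show False using u(1) v(2) by auto
qed

lemma (in graded_algebra) exists_homogeneous_frame:
  assumes "finite_dimensional_vector_space scale Basis"
  shows "\<exists>e \<delta> d. homogeneous_frame scale mul gop A e \<delta> d"
proof -
  interpret finite_dimensional_vector_space scale Basis by (rule assms)
  have "\<exists>B. B \<subseteq> A g \<and> finite B \<and> A g \<subseteq> span B" for g
    using basis_exists[of "A g"] finiteI_independent by metis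
  then obtain B where B: "\<And>g. B g \<subseteq> A g" "\<And>g. finite (B g)" "\<And>g. A g \<subseteq> span (B g)" by metis
  have finS: "finite (Supp A)" by (rule finite_Supp_if_finite_dimensional[OF assms])
  have "finite (Sigma (Supp A) B)" by (intro finite_SigmaI finS B(2))
  then obtain es where es: "set es = Sigma (Supp A) B"
    using finite_list by blast
  have mem: "fst (es ! i) \<in> Supp A \<and> snd (es ! i) \<in> B (fst (es ! i))" if "i < length es" for i
    using nth_mem[OF that] es by auto
  have "homogeneous_frame scale mul gop A (\<lambda>i. snd (es ! i)) (\<lambda>i. fst (es ! i)) (length es)"
  proof (unfold_locales)
    show "snd (es ! i) \<in> A (fst (es ! i))" "fst (es ! i) \<in> Supp A" if "i < length es" for i
      using mem[OF that] B(1) by auto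
    show "A g \<subseteq> span ((\<lambda>i. snd (es ! i)) ` {i. i < length es \<and> fst (es ! i) = g})" for g
    proof (cases "g \<in> Supp A")
      case True
      have "B g \<subseteq> (\<lambda>i. snd (es ! i)) ` {i. i < length es \<and> fst (es ! i) = g}"
      proof
        fix b assume "b \<in> B g"
        then have "(g, b) \<in> set es" using es True by auto
        then obtain i where "i < length es" "es ! i = (g, b)" by (auto simp: in_set_conv_nth)
        then show "b \<in> (\<lambda>i. snd (es ! i)) ` {i. i < length es \<and> fst (es ! i) = g}"
          by (intro image_eqI[of _ _ i]) auto
      qed
      then show ?thesis using B(3)[of g] span_mono by blast
    next
      case False
      then show ?thesis using span_zero by (auto simp: Supp_def)
    qed
    show "finite (Supp A)" by (rule finS)
  qed
  then show ?thesis by blast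
qed

section \<open>The graded PI-exponent\<close>

text \<open>Every monomial in at least two variables is a product.\<close>

lemma (in homogeneous_frame) pivot_lists_empty_if_mul_zero:
  assumes zero: "\<And>x y. mul x y = 0" and n: "2 \<le> n"
  shows "pivot_lists n = {}"
proof -
  have "F a = 0" if F: "F \<in> poly_maps (mset_set {..<n})" for F :: "(nat \<Rightarrow> 'a) \<Rightarrow> 'a" and a
  proof -
    obtain K c where K: "finite K" "\<forall>m\<in>K. monomial_vars m = mset_set {..<n}"
        "F = (\<lambda>a. \<Sum>m\<in>K. scale (c m) (eval_monomial mul a m))"
      using poly_mapsE[OF F] .
    have "eval_monomial mul a m = 0" if "m \<in> K" for m
    proof (cases m)
      case (Var x)
      then have "size (mset_set {..<n}) = 1" using K(2) that by (metis monomial_vars.simps(1) size_single)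
      then show ?thesis using n by simp
    qed (simp add: zero)
    then show ?thesis by (simp add: K(3))
  qed
  then show ?thesis by (auto simp: pivot_lists_def)
qed

theorem theorem3:
  fixes scale :: "'f::field_char_0 \<Rightarrow> 'a::ab_group_add \<Rightarrow> 'a"
    and mul :: "'a \<Rightarrow> 'a \<Rightarrow> 'a"
    and gop :: "'g \<Rightarrow> 'g \<Rightarrow> 'g"
    and A :: "'g \<Rightarrow> 'a set"
  assumes "graded_algebra scale mul gop A"
    and "\<exists>Basis. finite_dimensional_vector_space scale Basis"
    and "simple_algebra scale mul"
  shows "convergent (\<lambda>n. root n (real (graded_codim scale mul A n)))"
proof -
  interpret graded_algebra scale mul gop A by (rule assms(1))
  obtain Basis where fin: "finite_dimensional_vector_space scale Basis" using assms(2) by blast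
  obtain e \<delta> d where "homogeneous_frame scale mul gop A e \<delta> d"
    using exists_homogeneous_frame[OF fin] by blast
  then interpret homogeneous_frame scale mul gop A e \<delta> d .
  show ?thesis
  proof (cases "\<forall>x y. mul x y = 0")
    case True
    have "0 = root n (real (graded_codim scale mul A n))" if "2 \<le> n" for n
      using graded_codim_bounds(2)[of n] pivot_lists_empty_if_mul_zero[of n] True that by simp
    then have "\<forall>\<^sub>F n in sequentially. 0 = root n (real (graded_codim scale mul A n))"
      by (rule eventually_sequentiallyI)
    then show ?thesis
      by (intro convergentI[of _ 0] Lim_transform_eventually[OF tendsto_const])
  next
    case False
    then obtain x0 y0 where "mul x0 y0 \<noteq> 0" by blast
    then obtain R where R: "\<And>n k. card (pivot_lists n) \<le> card (pivot_lists (n + k))"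
        "\<And>n m. card (pivot_lists n) * card (pivot_lists m) \<le> card (pivot_lists (n + m + R))"
        "\<And>n. 1 \<le> n \<Longrightarrow> 1 \<le> card (pivot_lists n)"
      using card_pivot_lists_growth[OF fin assms(3)] by metis
    have "card (pivot_lists n) \<le> d ^ n" for n
      using card_mono[OF finite_frame_lists pivot_lists_subset, of n] by (simp add: card_frame_lists)
    then show ?thesis
      by (intro root_convergent_if_supermultiplicative[of "\<lambda>n. card (pivot_lists n)" R d])
        (use R graded_codim_bounds in auto)
  qed
qed

end
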